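(* Let $G$ be a Lie group with Lie algebra $\mathfrak{g}$ admitting a left invariant anti-Kähler structure $(g,J)$ such that $g$ is a bi-invariant metric and $g$ is Einstein with non-vanishing cosmological constant (i.e. $\operatorname{Rc}=\lambda g$ for some real constant $\lambda\neq 0$, where $\operatorname{Rc}$ is the Ricci tensor of $g$). Then $G$ is a semisimple Lie group and $J$ is a bi-invariant complex structure on $G$, i.e. $[JX,Y]=J[X,Y]$ for all $X,Y\in\mathfrak{g}$.
   Context: The Lie algebra $\mathfrak{g}$ of $G$ is the space of left invariant vector fields on $G$. A left invariant anti-Kähler structure on $G$ is a pair $(g,J)$ where $g$ is a left invariant pseudo-Riemannian metric on $G$, $J$ is a left invariant almost complex structure on $G$ (so $J$ maps $\mathfrak{g}$ to $\mathfrak{g}$ and $J^2=-\mathrm{Id}$), $g(JX,JY)=-g(X,Y)$ for all $X,Y$, and $\nabla J=0$ where $\nabla$ is the Levi-Civita connection of $g$. A metric is bi-invariant if it is both left and right invariant. A Lie group is semisimple if its Lie algebra is semisimple. *)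

theory Defs
  imports "HOL-Analysis.Analysis" "HOL-Library.Function_Algebras"
begin

section \<open>Real-valued function spaces as vector spaces\<close>

text \<open>The library has the pointwise ring operations on functions, but not the pointwise
  scalar multiplication. With it, tangent vectors and vector fields are elements of a
  type of class \<^class>\<open>real_vector\<close>.\<close>

instantiation "fun" :: (type, real_vector) real_vector
begin

definition scaleR_fun :: "real \<Rightarrow> ('a \<Rightarrow> 'b) \<Rightarrow> 'a \<Rightarrow> 'b" where
  "scaleR_fun r f = (\<lambda>x. r *\<^sub>R f x)"

instance
  by standard
    (simp_all add: scaleR_fun_def fun_eq_iff scaleR_add_right scaleR_add_left)

end

text \<open>Linearity of a map that is only meaningful on a subspace.\<close>

definition linear_between :: "'a::real_vector set \<Rightarrow> 'b::real_vector set \<Rightarrow> ('a \<Rightarrow> 'b) \<Rightarrow> bool" where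
  "linear_between V W T \<longleftrightarrow>
     (\<forall>u\<in>V. T u \<in> W) \<and>
     (\<forall>u\<in>V. \<forall>v\<in>V. T (u + v) = T u + T v) \<and>
     (\<forall>r. \<forall>u\<in>V. T (r *\<^sub>R u) = r *\<^sub>R T u)"

text \<open>The trace of an endomorphism of a finite-dimensional subspace \<open>V\<close>: the sum of the
  diagonal entries with respect to some basis of \<open>V\<close> (the value does not depend on the basis).\<close>

definition trace_on :: "'a::real_vector set \<Rightarrow> ('a \<Rightarrow> 'a) \<Rightarrow> real" where
  "trace_on V T =
     (let B = (SOME B. independent B \<and> span B = V) in \<Sum>b\<in>B. representation B (T b) b)"


section \<open>Smooth manifolds\<close>

text \<open>\<open>Ck_on k S f\<close> is meant for open sets \<open>S\<close>.\<close>

fun Ck_on :: "nat \<Rightarrow> 'a::real_normed_vector set \<Rightarrow> ('a \<Rightarrow> 'b::real_normed_vector) \<Rightarrow> bool" where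
  "Ck_on 0 S f \<longleftrightarrow> continuous_on S f"
| "Ck_on (Suc k) S f \<longleftrightarrow>
     (\<forall>x\<in>S. f differentiable (at x)) \<and> (\<forall>v. Ck_on k S (\<lambda>x. frechet_derivative f (at x) v))"

definition smooth_on :: "'a::real_normed_vector set \<Rightarrow> ('a \<Rightarrow> 'b::real_normed_vector) \<Rightarrow> bool" where
  "smooth_on S f \<longleftrightarrow> (\<forall>k. Ck_on k S f)"

text \<open>A chart is a pair of its domain and its coordinate map; only the values of the coordinate
  map on the domain matter. The inverse of a chart \<open>(U, \<phi>)\<close> is \<open>inv_into U \<phi>\<close>.\<close>

type_synonym ('m, 'e) chart = "'m set \<times> ('m \<Rightarrow> 'e)"

definition is_chart :: "('m::topological_space, 'e::euclidean_space) chart \<Rightarrow> bool" where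
  "is_chart c \<longleftrightarrow> (case c of (U, \<phi>) \<Rightarrow>
     open U \<and> open (\<phi> ` U) \<and> homeomorphism U (\<phi> ` U) \<phi> (inv_into U \<phi>))"

definition smooth_atlas :: "('m::topological_space, 'e::euclidean_space) chart set \<Rightarrow> bool" where
  "smooth_atlas A \<longleftrightarrow>
     (\<forall>c\<in>A. is_chart c) \<and>
     (\<Union>c\<in>A. fst c) = UNIV \<and>
     (\<forall>(U, \<phi>)\<in>A. \<forall>(V, \<psi>)\<in>A. smooth_on (\<phi> ` (U \<inter> V)) (\<psi> \<circ> inv_into U \<phi>))"

definition prod_atlas ::
  "('m, 'e) chart set \<Rightarrow> ('n, 'f) chart set \<Rightarrow> ('m \<times> 'n, 'e \<times> 'f) chart set" where
  "prod_atlas A B = {(U \<times> V, map_prod \<phi> \<psi>) | U \<phi> V \<psi>. (U, \<phi>) \<in> A \<and> (V, \<psi>) \<in> B}"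

text \<open>Smoothness, on an open set \<open>W\<close>, of a map between the manifolds with atlases \<open>A\<close> and \<open>B\<close>.\<close>

definition smooth_map_on ::
  "('m::topological_space, 'e::euclidean_space) chart set \<Rightarrow>
   ('n::topological_space, 'f::euclidean_space) chart set \<Rightarrow> 'm set \<Rightarrow> ('m \<Rightarrow> 'n) \<Rightarrow> bool" where
  "smooth_map_on A B W F \<longleftrightarrow>
     continuous_on W F \<and>
     (\<forall>(U, \<phi>)\<in>A. \<forall>(V, \<psi>)\<in>B.
        smooth_on (\<phi> ` {p \<in> U \<inter> W. F p \<in> V}) (\<psi> \<circ> F \<circ> inv_into U \<phi>))"

abbreviation smooth_fun_on ::
  "('m::topological_space, 'e::euclidean_space) chart set \<Rightarrow> 'm set \<Rightarrow> ('m \<Rightarrow> real) \<Rightarrow> bool" where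
  "smooth_fun_on A W f \<equiv> smooth_map_on A {(UNIV, id)} W f"

definition smooth_fun_near ::
  "('m::topological_space, 'e::euclidean_space) chart set \<Rightarrow> 'm \<Rightarrow> ('m \<Rightarrow> real) \<Rightarrow> bool" where
  "smooth_fun_near A p f \<longleftrightarrow> (\<exists>W. open W \<and> p \<in> W \<and> smooth_fun_on A W f)"


section \<open>Tangent vectors and vector fields\<close>

text \<open>A tangent vector at \<open>p\<close> is a directional derivative at \<open>p\<close>, that is
  \<open>\<Sum>i. w\<^sub>i \<partial>/\<partial>x\<^sub>i\<close> at \<open>p\<close> in the coordinates of some chart, as an operator on the functions that
  are smooth near \<open>p\<close>. On all other functions it takes the dummy value \<open>0\<close>, so that equality
  of operators is equality of tangent vectors.\<close>

type_synonym 'm tangent = "('m \<Rightarrow> real) \<Rightarrow> real"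

definition tangent_space ::
  "('m::topological_space, 'e::euclidean_space) chart set \<Rightarrow> 'm \<Rightarrow> 'm tangent set" where
  "tangent_space A p =
     {v. \<exists>(U, \<phi>)\<in>A. p \<in> U \<and> (\<exists>w. v = (\<lambda>f. if smooth_fun_near A p f
        then frechet_derivative (f \<circ> inv_into U \<phi>) (at (\<phi> p)) w else 0))}"

text \<open>The differential at \<open>p\<close> of a smooth map \<open>F\<close> from a manifold to one with atlas \<open>B\<close>.\<close>

definition differential ::
  "('n::topological_space, 'f::euclidean_space) chart set \<Rightarrow> ('m \<Rightarrow> 'n) \<Rightarrow> 'm \<Rightarrow>
   'm tangent \<Rightarrow> 'n tangent" where
  "differential B F p v = (\<lambda>f. if smooth_fun_near B (F p) f then v (f \<circ> F) else 0)"

type_synonym 'm vfield = "'m \<Rightarrow> 'm tangent"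

definition vector_field ::
  "('m::topological_space, 'e::euclidean_space) chart set \<Rightarrow> 'm vfield \<Rightarrow> bool" where
  "vector_field A X \<longleftrightarrow>
     (\<forall>p. X p \<in> tangent_space A p) \<and>
     (\<forall>W f. open W \<longrightarrow> smooth_fun_on A W f \<longrightarrow> smooth_fun_on A W (\<lambda>p. X p f))"

definition lie_bracket ::
  "('m::topological_space, 'e::euclidean_space) chart set \<Rightarrow> 'm vfield \<Rightarrow> 'm vfield \<Rightarrow> 'm vfield" where
  "lie_bracket A X Y = (\<lambda>p f. if smooth_fun_near A p f
     then X p (\<lambda>q. Y q f) - Y p (\<lambda>q. X q f) else 0)"

text \<open>Application of a field of endomorphisms, and multiplication by a function.\<close>

definition app_field :: "('m \<Rightarrow> 'm tangent \<Rightarrow> 'm tangent) \<Rightarrow> 'm vfield \<Rightarrow> 'm vfield" where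
  "app_field J X = (\<lambda>p. J p (X p))"

definition mult_field :: "('m \<Rightarrow> real) \<Rightarrow> 'm vfield \<Rightarrow> 'm vfield" where
  "mult_field h X = (\<lambda>p. h p *\<^sub>R X p)"


section \<open>Pseudo-Riemannian geometry\<close>

type_synonym 'm metric = "'m \<Rightarrow> 'm tangent \<Rightarrow> 'm tangent \<Rightarrow> real"

definition pseudo_riemannian ::
  "('m::topological_space, 'e::euclidean_space) chart set \<Rightarrow> 'm metric \<Rightarrow> bool" where
  "pseudo_riemannian A g \<longleftrightarrow>
     (\<forall>p. \<forall>u\<in>tangent_space A p. linear_between (tangent_space A p) UNIV (g p u)) \<and>
     (\<forall>p. \<forall>u\<in>tangent_space A p. \<forall>v\<in>tangent_space A p. g p u v = g p v u) \<and>
     (\<forall>p. \<forall>u\<in>tangent_space A p. (\<forall>v\<in>tangent_space A p. g p u v = 0) \<longrightarrow> u = 0) \<and>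
     (\<forall>X Y. vector_field A X \<longrightarrow> vector_field A Y \<longrightarrow>
        smooth_fun_on A UNIV (\<lambda>p. g p (X p) (Y p)))"

type_synonym 'm connection = "'m vfield \<Rightarrow> 'm vfield \<Rightarrow> 'm vfield"

definition affine_connection ::
  "('m::topological_space, 'e::euclidean_space) chart set \<Rightarrow> 'm connection \<Rightarrow> bool" where
  "affine_connection A D \<longleftrightarrow>
     (\<forall>X Y. vector_field A X \<longrightarrow> vector_field A Y \<longrightarrow> vector_field A (D X Y)) \<and>
     (\<forall>X Y Z. vector_field A X \<longrightarrow> vector_field A Y \<longrightarrow> vector_field A Z \<longrightarrow>
        D (X + Y) Z = D X Z + D Y Z \<and> D X (Y + Z) = D X Y + D X Z) \<and>
     (\<forall>h X Y. smooth_fun_on A UNIV h \<longrightarrow> vector_field A X \<longrightarrow> vector_field A Y \<longrightarrow>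
        D (mult_field h X) Y = mult_field h (D X Y) \<and>
        D X (mult_field h Y) = mult_field (\<lambda>p. X p h) Y + mult_field h (D X Y))"

text \<open>The Levi-Civita connection of \<open>g\<close> is the connection with this property: it exists
  and is determined by \<open>g\<close> on all (smooth) vector fields.\<close>

definition levi_civita ::
  "('m::topological_space, 'e::euclidean_space) chart set \<Rightarrow> 'm metric \<Rightarrow> 'm connection \<Rightarrow> bool" where
  "levi_civita A g D \<longleftrightarrow>
     affine_connection A D \<and>
     (\<forall>X Y. vector_field A X \<longrightarrow> vector_field A Y \<longrightarrow> D X Y - D Y X = lie_bracket A X Y) \<and>
     (\<forall>X Y Z p. vector_field A X \<longrightarrow> vector_field A Y \<longrightarrow> vector_field A Z \<longrightarrow>
        X p (\<lambda>q. g q (Y q) (Z q)) = g p (D X Y p) (Z p) + g p (Y p) (D X Z p))"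

definition curvature ::
  "('m::topological_space, 'e::euclidean_space) chart set \<Rightarrow> 'm connection \<Rightarrow>
   'm vfield \<Rightarrow> 'm vfield \<Rightarrow> 'm vfield \<Rightarrow> 'm vfield" where
  "curvature A D X Y Z = D X (D Y Z) - D Y (D X Z) - D (lie_bracket A X Y) Z"

text \<open>\<open>Rc(Y,Z)\<close> at \<open>p\<close> is the trace of \<open>u \<mapsto> R(u,Y)Z\<close> on the tangent space at \<open>p\<close>. Since the
  curvature is tensorial, \<open>R(u,Y)Z\<close> may be computed with any vector field that extends \<open>u\<close>.\<close>

definition extend_field ::
  "('m::topological_space, 'e::euclidean_space) chart set \<Rightarrow> 'm \<Rightarrow> 'm tangent \<Rightarrow> 'm vfield" where
  "extend_field A p u = (SOME X. vector_field A X \<and> X p = u)"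

definition ricci ::
  "('m::topological_space, 'e::euclidean_space) chart set \<Rightarrow> 'm connection \<Rightarrow>
   'm vfield \<Rightarrow> 'm vfield \<Rightarrow> 'm \<Rightarrow> real" where
  "ricci A D Y Z p =
     trace_on (tangent_space A p) (\<lambda>u. curvature A D (extend_field A p u) Y Z p)"

definition einstein ::
  "('m::topological_space, 'e::euclidean_space) chart set \<Rightarrow> 'm metric \<Rightarrow> real \<Rightarrow> bool" where
  "einstein A g c \<longleftrightarrow> (\<exists>D. levi_civita A g D \<and>
     (\<forall>Y Z p. vector_field A Y \<longrightarrow> vector_field A Z \<longrightarrow>
        ricci A D Y Z p = c * g p (Y p) (Z p)))"

definition almost_complex ::
  "('m::topological_space, 'e::euclidean_space) chart set \<Rightarrow>
   ('m \<Rightarrow> 'm tangent \<Rightarrow> 'm tangent) \<Rightarrow> bool" where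
  "almost_complex A J \<longleftrightarrow>
     (\<forall>p. linear_between (tangent_space A p) (tangent_space A p) (J p)) \<and>
     (\<forall>p. \<forall>u\<in>tangent_space A p. J p (J p u) = - u) \<and>
     (\<forall>X. vector_field A X \<longrightarrow> vector_field A (app_field J X))"

text \<open>Vanishing of the Nijenhuis tensor.\<close>

definition integrable_complex ::
  "('m::topological_space, 'e::euclidean_space) chart set \<Rightarrow>
   ('m \<Rightarrow> 'm tangent \<Rightarrow> 'm tangent) \<Rightarrow> bool" where
  "integrable_complex A J \<longleftrightarrow>
     (\<forall>X Y. vector_field A X \<longrightarrow> vector_field A Y \<longrightarrow>
        lie_bracket A (app_field J X) (app_field J Y) - lie_bracket A X Y
        = app_field J (lie_bracket A (app_field J X) Y + lie_bracket A X (app_field J Y)))"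

definition parallel_endo ::
  "('m::topological_space, 'e::euclidean_space) chart set \<Rightarrow> 'm connection \<Rightarrow>
   ('m \<Rightarrow> 'm tangent \<Rightarrow> 'm tangent) \<Rightarrow> bool" where
  "parallel_endo A D J \<longleftrightarrow>
     (\<forall>X Y. vector_field A X \<longrightarrow> vector_field A Y \<longrightarrow>
        D X (app_field J Y) - app_field J (D X Y) = 0)"

definition anti_kaehler ::
  "('m::topological_space, 'e::euclidean_space) chart set \<Rightarrow> 'm metric \<Rightarrow>
   ('m \<Rightarrow> 'm tangent \<Rightarrow> 'm tangent) \<Rightarrow> bool" where
  "anti_kaehler A g J \<longleftrightarrow>
     pseudo_riemannian A g \<and> almost_complex A J \<and>
     (\<forall>p. \<forall>u\<in>tangent_space A p. \<forall>v\<in>tangent_space A p. g p (J p u) (J p v) = - g p u v) \<and>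
     (\<exists>D. levi_civita A g D \<and> parallel_endo A D J)"


section \<open>Lie algebras\<close>

text \<open>A Lie algebra is given by its carrier, a subspace \<open>L\<close>, and its bracket \<open>b\<close>.\<close>

definition lie_ideal :: "'v::real_vector set \<Rightarrow> ('v \<Rightarrow> 'v \<Rightarrow> 'v) \<Rightarrow> 'v set \<Rightarrow> bool" where
  "lie_ideal L b I \<longleftrightarrow> subspace I \<and> I \<subseteq> L \<and> (\<forall>x\<in>L. \<forall>y\<in>I. b x y \<in> I)"

definition derived_algebra :: "('v::real_vector \<Rightarrow> 'v \<Rightarrow> 'v) \<Rightarrow> 'v set \<Rightarrow> 'v set" where
  "derived_algebra b I = span {b x y | x y. x \<in> I \<and> y \<in> I}"

definition solvable_algebra :: "('v::real_vector \<Rightarrow> 'v \<Rightarrow> 'v) \<Rightarrow> 'v set \<Rightarrow> bool" where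
  "solvable_algebra b I \<longleftrightarrow> (\<exists>n. (derived_algebra b ^^ n) I = {0})"

text \<open>Semisimple means that the radical, the largest solvable ideal, is zero.\<close>

definition semisimple_algebra :: "'v::real_vector set \<Rightarrow> ('v \<Rightarrow> 'v \<Rightarrow> 'v) \<Rightarrow> bool" where
  "semisimple_algebra L b \<longleftrightarrow> (\<forall>I. lie_ideal L b I \<longrightarrow> solvable_algebra b I \<longrightarrow> I = {0})"


section \<open>Lie groups\<close>

locale lie_group = group mul e inve
  for mul :: "'g::{t2_space, second_countable_topology} \<Rightarrow> 'g \<Rightarrow> 'g"
    and e :: 'g
    and inve :: "'g \<Rightarrow> 'g" +
  fixes A :: "('g, 'e::euclidean_space) chart set"
  assumes smooth_atlas: "smooth_atlas A"
    and smooth_mul: "smooth_map_on (prod_atlas A A) A UNIV (\<lambda>(a, p). mul a p)"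
    and smooth_inve: "smooth_map_on A A UNIV inve"

definition lie_algebra ::
  "('g \<Rightarrow> 'g \<Rightarrow> 'g) \<Rightarrow> ('g::topological_space, 'e::euclidean_space) chart set \<Rightarrow> 'g vfield set" where
  "lie_algebra mul A =
     {X. vector_field A X \<and> (\<forall>a p. X (mul a p) = differential A (mul a) p (X p))}"

definition semisimple_lie_group ::
  "('g \<Rightarrow> 'g \<Rightarrow> 'g) \<Rightarrow> ('g::topological_space, 'e::euclidean_space) chart set \<Rightarrow> bool" where
  "semisimple_lie_group mul A \<longleftrightarrow> semisimple_algebra (lie_algebra mul A) (lie_bracket A)"

definition isometry ::
  "('g::topological_space, 'e::euclidean_space) chart set \<Rightarrow> 'g metric \<Rightarrow> ('g \<Rightarrow> 'g) \<Rightarrow> bool" where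
  "isometry A g F \<longleftrightarrow>
     (\<forall>p. \<forall>u\<in>tangent_space A p. \<forall>v\<in>tangent_space A p.
        g (F p) (differential A F p u) (differential A F p v) = g p u v)"

definition left_invariant_metric ::
  "('g \<Rightarrow> 'g \<Rightarrow> 'g) \<Rightarrow> ('g::topological_space, 'e::euclidean_space) chart set \<Rightarrow>
   'g metric \<Rightarrow> bool" where
  "left_invariant_metric mul A g \<longleftrightarrow> (\<forall>a. isometry A g (\<lambda>p. mul a p))"

definition right_invariant_metric ::
  "('g \<Rightarrow> 'g \<Rightarrow> 'g) \<Rightarrow> ('g::topological_space, 'e::euclidean_space) chart set \<Rightarrow>
   'g metric \<Rightarrow> bool" where
  "right_invariant_metric mul A g \<longleftrightarrow> (\<forall>a. isometry A g (\<lambda>p. mul p a))"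

definition bi_invariant_metric ::
  "('g \<Rightarrow> 'g \<Rightarrow> 'g) \<Rightarrow> ('g::topological_space, 'e::euclidean_space) chart set \<Rightarrow>
   'g metric \<Rightarrow> bool" where
  "bi_invariant_metric mul A g \<longleftrightarrow> left_invariant_metric mul A g \<and> right_invariant_metric mul A g"

definition left_invariant_endo ::
  "('g \<Rightarrow> 'g \<Rightarrow> 'g) \<Rightarrow> ('g::topological_space, 'e::euclidean_space) chart set \<Rightarrow>
   ('g \<Rightarrow> 'g tangent \<Rightarrow> 'g tangent) \<Rightarrow> bool" where
  "left_invariant_endo mul A J \<longleftrightarrow>
     (\<forall>a p. \<forall>u\<in>tangent_space A p.
        J (mul a p) (differential A (mul a) p u) = differential A (mul a) p (J p u))"

definition left_invariant_anti_kaehler ::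
  "('g \<Rightarrow> 'g \<Rightarrow> 'g) \<Rightarrow> ('g::topological_space, 'e::euclidean_space) chart set \<Rightarrow>
   'g metric \<Rightarrow> ('g \<Rightarrow> 'g tangent \<Rightarrow> 'g tangent) \<Rightarrow> bool" where
  "left_invariant_anti_kaehler mul A g J \<longleftrightarrow>
     anti_kaehler A g J \<and> left_invariant_metric mul A g \<and> left_invariant_endo mul A J"

text \<open>As usual, bi-invariance of a left invariant complex structure \<open>J\<close> refers to the Lie algebra:
  \<open>ad\<close> is complex linear. On a disconnected group this does not make \<open>J\<close> invariant under all
  right translations.\<close>

definition bi_invariant_complex_structure ::
  "('g \<Rightarrow> 'g \<Rightarrow> 'g) \<Rightarrow> ('g::topological_space, 'e::euclidean_space) chart set \<Rightarrow>
   ('g \<Rightarrow> 'g tangent \<Rightarrow> 'g tangent) \<Rightarrow> bool" where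
  "bi_invariant_complex_structure mul A J \<longleftrightarrow>
     almost_complex A J \<and> integrable_complex A J \<and> left_invariant_endo mul A J \<and>
     (\<forall>X\<in>lie_algebra mul A. \<forall>Y\<in>lie_algebra mul A.
        lie_bracket A (app_field J X) Y = app_field J (lie_bracket A X Y))"

end

theory Submission
  imports Defs
begin

text \<open>Let \<open>X\<close>, \<open>Y\<close>, \<open>Z\<close> be left invariant. Then \<open>g(\<nabla>\<^sub>Y X, Z)\<close> is skew in \<open>X, Z\<close>, because \<open>g(X, Z)\<close> is
  constant, and skew in \<open>Y, Z\<close>, because \<open>X\<close> commutes with the right invariant fields, whose
  products are constant as well, and is therefore a Killing field. So it is alternating and
  \<open>\<nabla>\<^sub>X Y = [X, Y]/2\<close>. Now \<open>\<nabla>J = 0\<close> reads \<open>[X, JY] = J[X, Y]\<close>, and it makes the Nijenhuis tensor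
  vanish. If \<open>\<kk>\<close> is an abelian ideal and \<open>Z \<in> \<kk>\<close>, then \<open>X \<mapsto> R(X, Y)Z\<close> maps into \<open>\<kk>\<close> and kills
  \<open>\<kk>\<close>, so that its trace \<open>c g(Y, Z)\<close> is zero for all \<open>Y\<close>, and \<open>Z = 0\<close>. A non-zero solvable
  ideal would contain a non-zero abelian ideal.\<close>

section \<open>Calculus of smooth functions\<close>

text \<open>The Ricci form of a bi-invariant metric is -1/4 times the Killing form, so the trace
  argument is the classical proof that a non-degenerate Killing form excludes abelian ideals,
  carried out on the curvature itself.

  \<open>ricci\<close> evaluates the curvature on an unspecified field extending a tangent vector,
  so the algebra of left invariant fields applies only once the curvature is known to be tensorial.
  Cut-off functions are the usual tool for that; here a global left invariant frame does the same
  work, and the metric supplies its dual frame. Tensoriality also serves the Killing equation, where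
  a field is exchanged for a right invariant one with the same value at a point.

  Right invariance is used without flows: left and right invariant fields are the two partial
  derivatives of \<open>f (h p k)\<close> at \<open>h = k = e\<close>, and their commuting is the
  symmetry of second derivatives. The factor 1/2 comes from torsion: \<open>D X Y = - D Y X\<close>,
  while the difference of the two is the bracket.\<close>

lemma frechet_derivative_cong_open:
  assumes "open S" "x \<in> S" "\<And>y. y \<in> S \<Longrightarrow> f y = g y"
  shows "frechet_derivative f (at x) = frechet_derivative g (at x)"
proof -
  have "(f has_derivative D) (at x) \<longleftrightarrow> (g has_derivative D) (at x)" for D
    using has_derivative_transform_within_open[of f D x UNIV S g]
      has_derivative_transform_within_open[of g D x UNIV S f] assms by auto
  \<comment> \<open>\<open>frechet_derivative\<close> chooses a derivative by \<open>SOME\<close>,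
    so equal predicates give equal choices, even where no derivative exists.\<close>
  then show ?thesis by (simp add: frechet_derivative_def)
qed

lemma frechet_derivative_cong_eventually:
  assumes "\<forall>\<^sub>F y in nhds x. f y = g y"
  shows "frechet_derivative f (at x) = frechet_derivative g (at x)"
  using assms frechet_derivative_cong_open[of _ x f g] unfolding eventually_nhds by metis

lemma differentiable_cong_eventually:
  assumes "\<forall>\<^sub>F y in nhds x. f y = g y" "f differentiable (at x)"
  shows "g differentiable (at x)"
proof -
  obtain S where "open S" "x \<in> S" "\<forall>y\<in>S. f y = g y"
    using assms(1) unfolding eventually_nhds by auto
  then show ?thesis
    using assms(2) unfolding differentiable_def
    by (metis has_derivative_transform_within_open)
qed

lemma Ck_on_Suc_imp: "Ck_on (Suc k) S f \<Longrightarrow> Ck_on k S f"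
proof (induction k arbitrary: f)
  case 0
  then show ?case
    by (auto intro!: continuous_at_imp_continuous_on differentiable_imp_continuous_within)
next
  case (Suc k)
  have "Ck_on k S (\<lambda>x. frechet_derivative f (at x) v)" for v
    using Suc.IH Suc.prems by simp
  with Suc.prems show ?case by simp
qed

text \<open>The closure rules below compute a derivative by a formula that is valid only on
  \<open>S\<close>; this lemma carries the regularity of the formula over to
  \<open>frechet_derivative\<close>. Openness of \<open>S\<close> makes all further derivatives
  agree as well.\<close>

lemma Ck_on_cong:
  assumes "open S" "\<And>x. x \<in> S \<Longrightarrow> f x = g x" "Ck_on k S f"
  shows "Ck_on k S g"
  using assms(2,3)
proof (induction k arbitrary: f g)
  case 0
  then show ?case using continuous_on_cong[of S S f g] by auto
next
  case (Suc k)
  have ev: "\<forall>\<^sub>F y in nhds x. f y = g y" if "x \<in> S" for x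
    using that assms(1) Suc.prems(1) unfolding eventually_nhds by auto
  have "Ck_on k S (\<lambda>x. frechet_derivative g (at x) v)" for v
    using Suc.IH[of "\<lambda>x. frechet_derivative f (at x) v" "\<lambda>x. frechet_derivative g (at x) v"]
      Suc.prems(2) frechet_derivative_cong_eventually[OF ev] by simp
  then show ?case
    using differentiable_cong_eventually[OF ev] Suc.prems(2) by simp
qed

lemma Ck_on_subset: "Ck_on k S f \<Longrightarrow> T \<subseteq> S \<Longrightarrow> Ck_on k T f"
  by (induction k arbitrary: f) (auto intro: continuous_on_subset)

text \<open>\<open>Ck_on\<close> takes derivatives in the full space and not within
  \<open>S\<close>, so it is a condition on neighbourhoods of the points of
  \<open>S\<close>.\<close>

lemma Ck_on_local:
  assumes "\<And>x. x \<in> S \<Longrightarrow> \<exists>N. open N \<and> x \<in> N \<and> Ck_on k N f"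
  shows "Ck_on k S f"
  using assms
proof (induction k arbitrary: f)
  case 0
  have "isCont f x" if "x \<in> S" for x
    using 0[OF that] continuous_on_eq_continuous_at by auto
  then show ?case by (simp add: continuous_at_imp_continuous_on)
next
  case (Suc k)
  have "Ck_on k S (\<lambda>x. frechet_derivative f (at x) v)" for v
  proof (rule Suc.IH)
    fix x assume "x \<in> S"
    then show "\<exists>N. open N \<and> x \<in> N \<and> Ck_on k N (\<lambda>x. frechet_derivative f (at x) v)"
      using Suc.prems[of x] by auto
  qed
  moreover have "f differentiable (at x)" if "x \<in> S" for x
    using Suc.prems[OF that] by auto
  ultimately show ?case by simp
qed

lemma Ck_on_const: "Ck_on k S (\<lambda>x. c)"
  by (induction k arbitrary: c) auto

lemma Ck_on_bounded_linear:
  assumes "bounded_linear L"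
  shows "Ck_on k S L"
proof (cases k)
  case 0
  then show ?thesis using assms by (simp add: linear_continuous_on)
next
  case (Suc m)
  have d: "(L has_derivative L) (at x)" for x
    using assms by (rule bounded_linear_imp_has_derivative)
  then have "frechet_derivative L (at x) = L" for x
    by (metis frechet_derivative_at)
  then show ?thesis using Suc d by (auto simp: Ck_on_const differentiable_def)
qed

lemma Ck_on_bounded_linear_compose:
  assumes "bounded_linear L" "open S" "Ck_on k S f"
  shows "Ck_on k S (\<lambda>x. L (f x))"
  using assms(3)
proof (induction k arbitrary: f)
  case 0
  then show ?case using bounded_linear.continuous_on[OF assms(1)] by simp
next
  case (Suc k)
  have d: "((\<lambda>x. L (f x)) has_derivative (\<lambda>v. L (frechet_derivative f (at x) v))) (at x)"
    if "x \<in> S" for x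
    using Suc.prems that
    by (intro bounded_linear.has_derivative[OF assms(1)]) (simp add: frechet_derivative_works[symmetric])
  have "Ck_on k S (\<lambda>x. L (frechet_derivative f (at x) v))" for v
    using Suc by simp
  then have "Ck_on k S (\<lambda>x. frechet_derivative (\<lambda>x. L (f x)) (at x) v)" for v
    by (rule Ck_on_cong[OF assms(2), rotated]) (simp add: frechet_derivative_at[OF d, symmetric])
  then show ?case using d by (auto simp: differentiable_def)
qed

lemma Ck_on_add:
  assumes "open S" "Ck_on k S f" "Ck_on k S g"
  shows "Ck_on k S (\<lambda>x. f x + g x)"
  using assms(2,3)
proof (induction k arbitrary: f g)
  case 0
  then show ?case by (simp add: continuous_on_add)
next
  case (Suc k)
  have d: "((\<lambda>x. f x + g x) has_derivative
      (\<lambda>v. frechet_derivative f (at x) v + frechet_derivative g (at x) v)) (at x)" if "x \<in> S" for x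
    using Suc.prems that by (auto simp: frechet_derivative_works intro!: has_derivative_add)
  have "Ck_on k S (\<lambda>x. frechet_derivative f (at x) v + frechet_derivative g (at x) v)" for v
    using Suc by simp
  then have "Ck_on k S (\<lambda>x. frechet_derivative (\<lambda>x. f x + g x) (at x) v)" for v
    by (rule Ck_on_cong[OF assms(1), rotated]) (simp add: frechet_derivative_at[OF d, symmetric])
  then show ?case using d by (auto simp: differentiable_def)
qed

lemma Ck_on_sum:
  assumes "open S" "\<And>i. i \<in> I \<Longrightarrow> Ck_on k S (f i)"
  shows "Ck_on k S (\<lambda>x. \<Sum>i\<in>I. f i x)"
  using assms(2)
  by (induction I rule: infinite_finite_induct) (auto intro: Ck_on_add Ck_on_const assms(1))

lemma Ck_on_scaleR:
  fixes f :: "'a::real_normed_vector \<Rightarrow> real" and g :: "'a \<Rightarrow> 'b::real_normed_vector"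
  assumes "open S" "Ck_on k S f" "Ck_on k S g"
  shows "Ck_on k S (\<lambda>x. f x *\<^sub>R g x)"
  using assms(2,3)
proof (induction k arbitrary: f g)
  case 0
  then show ?case by (simp add: continuous_on_scaleR)
next
  case (Suc k)
  have d: "((\<lambda>x. f x *\<^sub>R g x) has_derivative
      (\<lambda>v. f x *\<^sub>R frechet_derivative g (at x) v + frechet_derivative f (at x) v *\<^sub>R g x)) (at x)"
    if "x \<in> S" for x
    using Suc.prems that by (auto simp: frechet_derivative_works intro!: has_derivative_scaleR)
  have "Ck_on k S (\<lambda>x. f x *\<^sub>R frechet_derivative g (at x) v + frechet_derivative f (at x) v *\<^sub>R g x)" for v
    using Suc Ck_on_Suc_imp[of k S f] Ck_on_Suc_imp[of k S g] by (intro Ck_on_add assms(1)) simp_all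
  then have "Ck_on k S (\<lambda>x. frechet_derivative (\<lambda>x. f x *\<^sub>R g x) (at x) v)" for v
    by (rule Ck_on_cong[OF assms(1), rotated]) (simp add: frechet_derivative_at[OF d, symmetric])
  then show ?case using d by (auto simp: differentiable_def)
qed

text \<open>In the chain rule the outer derivative is applied to a direction that varies with the
  point, whereas \<open>Ck_on\<close> speaks of fixed directions. Expanding the direction in
  \<open>Basis\<close> of the middle space leaves products of scalar functions with derivatives in
  fixed directions, to which the induction hypothesis applies.\<close>

lemma Ck_on_compose:
  fixes g :: "'a::real_normed_vector \<Rightarrow> 'b::euclidean_space"
    and f :: "'b \<Rightarrow> 'c::real_normed_vector"
  assumes "open S" "g ` S \<subseteq> T" "Ck_on k S g" "Ck_on k T f"
  shows "Ck_on k S (\<lambda>x. f (g x))"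
  using assms(3,4)
proof (induction k arbitrary: f)
  case 0
  then show ?case using assms(2) continuous_on_compose2[of T f S g] by simp
next
  case (Suc k)
  let ?D = "\<lambda>x v. \<Sum>b\<in>Basis. (frechet_derivative g (at x) v \<bullet> b) *\<^sub>R frechet_derivative f (at (g x)) b"
  have d: "((\<lambda>x. f (g x)) has_derivative ?D x) (at x)" if "x \<in> S" for x
  proof -
    have fd: "(f has_derivative frechet_derivative f (at (g x))) (at (g x))"
      using Suc.prems that assms(2) by (auto simp: frechet_derivative_works)
    then have lin: "linear (frechet_derivative f (at (g x)))"
      by (rule has_derivative_linear)
    have c: "((\<lambda>x. f (g x)) has_derivative
        (\<lambda>v. frechet_derivative f (at (g x)) (frechet_derivative g (at x) v))) (at x)"
      using Suc.prems that fd by (intro has_derivative_compose[of g _ x UNIV f])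
        (auto simp: frechet_derivative_works)
    have e: "frechet_derivative f (at (g x)) u =
        (\<Sum>b\<in>Basis. (u \<bullet> b) *\<^sub>R frechet_derivative f (at (g x)) b)" for u
    proof -
      have "L u = (\<Sum>b\<in>Basis. (u \<bullet> b) *\<^sub>R L b)" if L: "linear L" for L :: "'b \<Rightarrow> 'c"
      proof -
        have "L u = L (\<Sum>b\<in>Basis. (u \<bullet> b) *\<^sub>R b)"
          by (simp only: euclidean_representation)
        also have "\<dots> = (\<Sum>b\<in>Basis. L ((u \<bullet> b) *\<^sub>R b))"
          by (rule linear_sum[OF L])
        finally show ?thesis by (simp only: linear_scale[OF L])
      qed
      then show ?thesis using lin by blast
    qed
    show ?thesis by (rule has_derivative_eq_rhs[OF c]) (rule ext, rule e)
  qed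
  have "Ck_on k S (\<lambda>x. ?D x v)" for v
  proof (intro Ck_on_sum assms(1) Ck_on_scaleR)
    fix b :: 'b
    show "Ck_on k S (\<lambda>x. frechet_derivative g (at x) v \<bullet> b)"
      using Suc.prems(1) assms(1)
      by (intro Ck_on_bounded_linear_compose[of "\<lambda>u. u \<bullet> b"] bounded_linear_inner_left) simp_all
    show "Ck_on k S (\<lambda>x. frechet_derivative f (at (g x)) b)"
      using Suc.IH[of "\<lambda>y. frechet_derivative f (at y) b"] Suc.prems Ck_on_Suc_imp[of k S g] by simp
  qed
  then have "Ck_on k S (\<lambda>x. frechet_derivative (\<lambda>x. f (g x)) (at x) v)" for v
    by (rule Ck_on_cong[OF assms(1), rotated]) (simp add: frechet_derivative_at[OF d, symmetric])
  then show ?case using d by (auto simp: differentiable_def)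
qed

text \<open>Smoothness of a germ. It combines with \<open>eventually\<close> arguments, so that the
  shrinking domains of coordinate expressions need not be tracked.\<close>

definition smooth_at :: "('a::real_normed_vector \<Rightarrow> 'b::real_normed_vector) \<Rightarrow> 'a \<Rightarrow> bool" where
  "smooth_at f x \<longleftrightarrow> (\<exists>N. open N \<and> x \<in> N \<and> smooth_on N f)"

lemma smooth_on_imp_smooth_at: "smooth_on S f \<Longrightarrow> open S \<Longrightarrow> x \<in> S \<Longrightarrow> smooth_at f x"
  unfolding smooth_at_def by blast

lemma smooth_on_if_smooth_at: "(\<And>x. x \<in> S \<Longrightarrow> smooth_at f x) \<Longrightarrow> smooth_on S f"
  unfolding smooth_on_def smooth_at_def by (meson Ck_on_local)

lemma smooth_at_eventually:
  assumes "smooth_at f x"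
  shows "\<forall>\<^sub>F y in nhds x. smooth_at f y"
  using assms unfolding smooth_at_def eventually_nhds by blast

lemma smooth_at_cong:
  assumes "\<forall>\<^sub>F y in nhds x. f y = g y" "smooth_at f x"
  shows "smooth_at g x"
proof -
  obtain S where S: "open S" "x \<in> S" "\<forall>y\<in>S. f y = g y"
    using assms(1) unfolding eventually_nhds by auto
  obtain N where N: "open N" "x \<in> N" "smooth_on N f"
    using assms(2) unfolding smooth_at_def by auto
  have "smooth_on (S \<inter> N) g"
    using S N Ck_on_cong[of "S \<inter> N" f g] Ck_on_subset[of _ N f "S \<inter> N"]
    unfolding smooth_on_def by blast
  then show ?thesis unfolding smooth_at_def using S N by blast
qed

lemma smooth_on_differentiable: "smooth_on S f \<Longrightarrow> x \<in> S \<Longrightarrow> f differentiable (at x)"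
  unfolding smooth_on_def by (drule spec[of _ "Suc 0"]) simp

lemma smooth_on_frechet_derivative:
  "smooth_on S f \<Longrightarrow> smooth_on S (\<lambda>x. frechet_derivative f (at x) v)"
  unfolding smooth_on_def
proof
  fix k assume "\<forall>k. Ck_on k S f"
  then have "Ck_on (Suc k) S f" by blast
  then show "Ck_on k S (\<lambda>x. frechet_derivative f (at x) v)" by simp
qed

lemma smooth_on_continuous_on: "smooth_on S f \<Longrightarrow> continuous_on S f"
  unfolding smooth_on_def by (drule spec[of _ 0]) simp

lemma smooth_at_differentiable: "smooth_at f x \<Longrightarrow> f differentiable (at x)"
  unfolding smooth_at_def using smooth_on_differentiable by blast

lemma smooth_at_has_derivative:
  "smooth_at f x \<Longrightarrow> (f has_derivative frechet_derivative f (at x)) (at x)"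
  using smooth_at_differentiable frechet_derivative_works by blast

lemma smooth_at_isCont: "smooth_at f x \<Longrightarrow> isCont f x"
  using smooth_at_differentiable differentiable_imp_continuous_within by blast

lemma smooth_at_frechet_derivative:
  "smooth_at f x \<Longrightarrow> smooth_at (\<lambda>y. frechet_derivative f (at y) v) x"
  unfolding smooth_at_def using smooth_on_frechet_derivative by blast

lemma smooth_at_const: "smooth_at (\<lambda>x. c) x"
  unfolding smooth_at_def smooth_on_def by (blast intro: Ck_on_const)

lemma smooth_at_bounded_linear: "bounded_linear L \<Longrightarrow> smooth_at L x"
  unfolding smooth_at_def smooth_on_def by (blast intro: Ck_on_bounded_linear)

lemma smooth_at_add:
  assumes "smooth_at f x" "smooth_at g x"
  shows "smooth_at (\<lambda>y. f y + g y) x"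
proof -
  obtain M N where "open M" "x \<in> M" "smooth_on M f" "open N" "x \<in> N" "smooth_on N g"
    using assms unfolding smooth_at_def by blast
  then show ?thesis unfolding smooth_at_def smooth_on_def
    by (intro exI[of _ "M \<inter> N"]) (auto intro!: Ck_on_add intro: Ck_on_subset)
qed

lemma smooth_at_scaleR:
  fixes f :: "'a::real_normed_vector \<Rightarrow> real"
  assumes "smooth_at f x" "smooth_at g x"
  shows "smooth_at (\<lambda>y. f y *\<^sub>R g y) x"
proof -
  obtain M N where "open M" "x \<in> M" "smooth_on M f" "open N" "x \<in> N" "smooth_on N g"
    using assms unfolding smooth_at_def by blast
  then show ?thesis unfolding smooth_at_def smooth_on_def
    by (intro exI[of _ "M \<inter> N"]) (auto intro!: Ck_on_scaleR intro: Ck_on_subset)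
qed

lemma smooth_at_compose:
  fixes g :: "'a::real_normed_vector \<Rightarrow> 'b::euclidean_space"
  assumes "smooth_at g x" "smooth_at f (g x)"
  shows "smooth_at (\<lambda>y. f (g y)) x"
proof -
  obtain M N where M: "open M" "x \<in> M" "smooth_on M g" and N: "open N" "g x \<in> N" "smooth_on N f"
    using assms unfolding smooth_at_def by blast
  have "continuous_on M g"
    using M(3) by (rule smooth_on_continuous_on)
  then have "open (M \<inter> g -` N)" using M(1) N(1)
    by (simp add: continuous_open_preimage)
  moreover have "Ck_on k (M \<inter> g -` N) (\<lambda>y. f (g y))" for k
  proof (rule Ck_on_compose[where T = N])
    show "Ck_on k (M \<inter> g -` N) g" "Ck_on k N f"
      using M(3) N(3) Ck_on_subset[of k M g] unfolding smooth_on_def by blast+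
  qed (use calculation in auto)
  ultimately show ?thesis unfolding smooth_at_def smooth_on_def
    using M N by (intro exI[of _ "M \<inter> g -` N"]) auto
qed

lemma smooth_at_bounded_linear_compose:
  assumes "bounded_linear L" "smooth_at f x"
  shows "smooth_at (\<lambda>y. L (f y)) x"
  using assms Ck_on_bounded_linear_compose[OF assms(1)] unfolding smooth_at_def smooth_on_def
  by blast

lemma smooth_at_Pair:
  assumes "smooth_at f x" "smooth_at g x"
  shows "smooth_at (\<lambda>y. (f y, g y)) x"
proof -
  have "smooth_at (\<lambda>y. (f y, 0) + (0, g y)) x"
    using assms by (intro smooth_at_add smooth_at_bounded_linear_compose[of "\<lambda>u. (u, 0)"]
      smooth_at_bounded_linear_compose[of "\<lambda>u. (0, u)"] bounded_linear_Pair
      bounded_linear_ident bounded_linear_zero)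
  then show ?thesis by simp
qed

lemma frechet_derivative_chain:
  assumes "smooth_at g x" "smooth_at f (g x)"
  shows "frechet_derivative (\<lambda>y. f (g y)) (at x) v =
    frechet_derivative f (at (g x)) (frechet_derivative g (at x) v)"
proof -
  have "((\<lambda>y. f (g y)) has_derivative
      (\<lambda>v. frechet_derivative f (at (g x)) (frechet_derivative g (at x) v))) (at x)"
    using assms by (intro has_derivative_compose[of g _ x UNIV f] smooth_at_has_derivative)
  then show ?thesis by (metis frechet_derivative_at)
qed

text \<open>The group multiplication in coordinates is a function of two variables. Slices turn
  derivatives along translations, with one factor fixed, into partial derivatives of that
  function.\<close>

lemma smooth_at_slice_fst:
  fixes H :: "'a::euclidean_space \<times> 'b::euclidean_space \<Rightarrow> 'c::real_normed_vector"
  assumes "smooth_at H (a, b)"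
  shows "smooth_at (\<lambda>x. H (x, b)) a"
    and "frechet_derivative (\<lambda>x. H (x, b)) (at a) v = frechet_derivative H (at (a, b)) (v, 0)"
proof -
  have s: "smooth_at (\<lambda>x. (x, b)) a"
    by (intro smooth_at_Pair smooth_at_bounded_linear smooth_at_const bounded_linear_ident)
  have "((\<lambda>x. (x, b)) has_derivative (\<lambda>v. (v, 0))) (at a)"
    by (intro derivative_intros)
  then have "frechet_derivative (\<lambda>x. (x, b)) (at a) = (\<lambda>v. (v, 0))"
    by (metis frechet_derivative_at)
  then show "smooth_at (\<lambda>x. H (x, b)) a"
    "frechet_derivative (\<lambda>x. H (x, b)) (at a) v = frechet_derivative H (at (a, b)) (v, 0)"
    using smooth_at_compose[OF s, of H] frechet_derivative_chain[OF s, of H] assms by simp_all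
qed

lemma smooth_at_slice_snd:
  fixes H :: "'a::euclidean_space \<times> 'b::euclidean_space \<Rightarrow> 'c::real_normed_vector"
  assumes "smooth_at H (a, b)"
  shows "smooth_at (\<lambda>y. H (a, y)) b"
    and "frechet_derivative (\<lambda>y. H (a, y)) (at b) v = frechet_derivative H (at (a, b)) (0, v)"
proof -
  have s: "smooth_at (\<lambda>y. (a, y)) b"
    by (intro smooth_at_Pair smooth_at_bounded_linear smooth_at_const bounded_linear_ident)
  have "((\<lambda>y. (a, y)) has_derivative (\<lambda>v. (0, v))) (at b)"
    by (intro derivative_intros)
  then have "frechet_derivative (\<lambda>y. (a, y)) (at b) = (\<lambda>v. (0, v))"
    by (metis frechet_derivative_at)
  then show "smooth_at (\<lambda>y. H (a, y)) b"
    "frechet_derivative (\<lambda>y. H (a, y)) (at b) v = frechet_derivative H (at (a, b)) (0, v)"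
    using smooth_at_compose[OF s, of H] frechet_derivative_chain[OF s, of H] assms by simp_all
qed

text \<open>Two applications of the mean value theorem to the second difference of \<open>F\<close>, which is
  symmetric in \<open>a\<close> and \<open>b\<close>.\<close>

lemma second_difference_mean_value:
  fixes F :: "'a::real_normed_vector \<Rightarrow> real"
  assumes h: "h > 0"
    and S: "\<And>s t. 0 \<le> s \<Longrightarrow> s \<le> h \<Longrightarrow> 0 \<le> t \<Longrightarrow> t \<le> h \<Longrightarrow> smooth_at F (z + s *\<^sub>R a + t *\<^sub>R b)"
  obtains s t where "0 < s" "s < h" "0 < t" "t < h"
    "F (z + h *\<^sub>R a + h *\<^sub>R b) - F (z + h *\<^sub>R a) - F (z + h *\<^sub>R b) + F z =
      h * (h * frechet_derivative (\<lambda>y. frechet_derivative F (at y) a) (at (z + s *\<^sub>R a + t *\<^sub>R b)) b)"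
proof -
  let ?Fa = "\<lambda>y. frechet_derivative F (at y) a"
  have d1: "((\<lambda>s. F (z + s *\<^sub>R a + t *\<^sub>R b)) has_real_derivative ?Fa (z + s *\<^sub>R a + t *\<^sub>R b)) (at s)"
    if "0 \<le> s" "s \<le> h" "0 \<le> t" "t \<le> h" for s t
  proof -
    have F: "(F has_derivative frechet_derivative F (at (z + s *\<^sub>R a + t *\<^sub>R b))) (at (z + s *\<^sub>R a + t *\<^sub>R b))"
      using smooth_at_has_derivative[OF S[OF that]] .
    have "((\<lambda>s. z + s *\<^sub>R a + t *\<^sub>R b) has_derivative (\<lambda>r. r *\<^sub>R a)) (at s)"
      by (auto intro!: derivative_eq_intros)
    from has_derivative_compose[OF this F]
    show ?thesis
      unfolding has_field_derivative_def
      by (simp add: linear_scale[OF has_derivative_linear[OF F]] mult.commute[of _ "?Fa _"])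
  qed
  have "\<exists>s. 0 < s \<and> s < h \<and>
      (F (z + h *\<^sub>R a + h *\<^sub>R b) - F (z + h *\<^sub>R a + 0 *\<^sub>R b)) - (F (z + 0 *\<^sub>R a + h *\<^sub>R b) - F (z + 0 *\<^sub>R a + 0 *\<^sub>R b))
      = (h - 0) * (?Fa (z + s *\<^sub>R a + h *\<^sub>R b) - ?Fa (z + s *\<^sub>R a + 0 *\<^sub>R b))"
    by (rule MVT2[OF h]) (intro DERIV_diff d1; use h in auto)
  then obtain s where s: "0 < s" "s < h" and seq:
      "F (z + h *\<^sub>R a + h *\<^sub>R b) - F (z + h *\<^sub>R a) - F (z + h *\<^sub>R b) + F z
      = h * (?Fa (z + s *\<^sub>R a + h *\<^sub>R b) - ?Fa (z + s *\<^sub>R a + 0 *\<^sub>R b))"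
    by (auto simp: algebra_simps)
  have d2: "((\<lambda>t. ?Fa (z + s *\<^sub>R a + t *\<^sub>R b)) has_real_derivative
      frechet_derivative ?Fa (at (z + s *\<^sub>R a + t *\<^sub>R b)) b) (at t)"
    if "0 \<le> t" "t \<le> h" for t
  proof -
    have F: "(?Fa has_derivative frechet_derivative ?Fa (at (z + s *\<^sub>R a + t *\<^sub>R b))) (at (z + s *\<^sub>R a + t *\<^sub>R b))"
      using s that by (intro smooth_at_has_derivative smooth_at_frechet_derivative S) auto
    have "((\<lambda>t. z + s *\<^sub>R a + t *\<^sub>R b) has_derivative (\<lambda>r. r *\<^sub>R b)) (at t)"
      by (auto intro!: derivative_eq_intros)
    from has_derivative_compose[OF this F]
    show ?thesis
      unfolding has_field_derivative_def
      by (simp add: linear_scale[OF has_derivative_linear[OF F]] mult.commute[of _ "frechet_derivative ?Fa _ _"])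
  qed
  have "\<exists>t. 0 < t \<and> t < h \<and>
    ?Fa (z + s *\<^sub>R a + h *\<^sub>R b) - ?Fa (z + s *\<^sub>R a + 0 *\<^sub>R b) =
      (h - 0) * frechet_derivative ?Fa (at (z + s *\<^sub>R a + t *\<^sub>R b)) b"
    by (rule MVT2[OF h]) (rule d2)
  then obtain t where "0 < t" "t < h"
    "?Fa (z + s *\<^sub>R a + h *\<^sub>R b) - ?Fa (z + s *\<^sub>R a + 0 *\<^sub>R b) =
      (h - 0) * frechet_derivative ?Fa (at (z + s *\<^sub>R a + t *\<^sub>R b)) b"
    by blast
  with s seq show ?thesis by (intro that[of s t]) simp_all
qed

text \<open>If the mixed derivatives differed at \<open>z\<close>, continuity would keep them apart
  on a neighbourhood. But on a small parallelogram one and the same second difference equals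
  \<open>h * h\<close> times a nearby value of each.\<close>

lemma frechet_derivative_commute:
  fixes F :: "'a::real_normed_vector \<Rightarrow> real"
  assumes "smooth_at F z"
  shows "frechet_derivative (\<lambda>y. frechet_derivative F (at y) a) (at z) b =
    frechet_derivative (\<lambda>y. frechet_derivative F (at y) b) (at z) a" (is "?P z = ?Q z")
proof (rule ccontr)
  assume ne: "?P z \<noteq> ?Q z"
  \<comment> \<open>Half the gap, so that values within \<open>\<epsilon>\<close> of
    \<open>?P z\<close> and of \<open>?Q z\<close> cannot coincide.\<close>
  define \<epsilon> where "\<epsilon> = dist (?P z) (?Q z) / 2"
  have \<epsilon>: "\<epsilon> > 0" using ne by (simp add: \<epsilon>_def)
  have near_value: "\<forall>\<^sub>F y in nhds z. dist (R y) (R z) < \<epsilon>" if "isCont R z" for R :: "'a \<Rightarrow> real"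
    using that \<epsilon> by (auto simp: isCont_def tendsto_at_iff_tendsto_nhds dest: tendstoD)
  have "\<forall>\<^sub>F y in nhds z. dist (?P y) (?P z) < \<epsilon>" "\<forall>\<^sub>F y in nhds z. dist (?Q y) (?Q z) < \<epsilon>"
    by (intro near_value smooth_at_isCont smooth_at_frechet_derivative assms)+
  then have "\<forall>\<^sub>F y in nhds z. smooth_at F y \<and> dist (?P y) (?P z) < \<epsilon> \<and> dist (?Q y) (?Q z) < \<epsilon>"
    using smooth_at_eventually[OF assms] by eventually_elim auto
  then obtain d where d: "d > 0"
    "\<And>y. dist y z < d \<Longrightarrow> smooth_at F y \<and> dist (?P y) (?P z) < \<epsilon> \<and> dist (?Q y) (?Q z) < \<epsilon>"
    unfolding eventually_nhds_metric by blast
  \<comment> \<open>This keeps the parallelogram with sides \<open>h *\<^sub>R a\<close> and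
    \<open>h *\<^sub>R b\<close> inside the ball of radius \<open>d\<close>; the summand 1 makes the
    bound strict and the denominator positive.\<close>
  define h where "h = d / (norm a + norm b + 1)"
  have pos: "norm a + norm b + 1 > 0" using norm_ge_zero[of a] norm_ge_zero[of b] by linarith
  then have h: "h > 0" using d(1) by (simp add: h_def)
  have near: "dist (z + s *\<^sub>R a + t *\<^sub>R b) z < d" if "0 \<le> s" "s \<le> h" "0 \<le> t" "t \<le> h" for s t
  proof -
    have "norm (s *\<^sub>R a + t *\<^sub>R b) \<le> s * norm a + t * norm b"
      using norm_triangle_ineq[of "s *\<^sub>R a" "t *\<^sub>R b"] that by simp
    also have "\<dots> \<le> h * norm a + h * norm b"
      using that by (intro add_mono mult_right_mono) auto
    also have "\<dots> < h * (norm a + norm b + 1)" using h by (simp add: algebra_simps)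
    also have "\<dots> = d" using pos by (simp add: h_def)
    finally show ?thesis by (simp add: dist_norm add.assoc)
  qed
  have Sab: "smooth_at F (z + s *\<^sub>R a + t *\<^sub>R b)"
    if "0 \<le> s" "s \<le> h" "0 \<le> t" "t \<le> h" for s t
    using d(2)[OF near[OF that]] by blast
  have Sba: "smooth_at F (z + s *\<^sub>R b + t *\<^sub>R a)"
    if "0 \<le> s" "s \<le> h" "0 \<le> t" "t \<le> h" for s t
    using Sab[OF that(3,4,1,2)] by (simp add: ac_simps)
  obtain s t where st: "0 < s" "s < h" "0 < t" "t < h"
    "F (z + h *\<^sub>R a + h *\<^sub>R b) - F (z + h *\<^sub>R a) - F (z + h *\<^sub>R b) + F z =
      h * (h * ?P (z + s *\<^sub>R a + t *\<^sub>R b))"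
    by (rule second_difference_mean_value[OF h Sab])
  obtain t' s' where st': "0 < t'" "t' < h" "0 < s'" "s' < h"
    "F (z + h *\<^sub>R b + h *\<^sub>R a) - F (z + h *\<^sub>R b) - F (z + h *\<^sub>R a) + F z =
      h * (h * ?Q (z + t' *\<^sub>R b + s' *\<^sub>R a))"
    by (rule second_difference_mean_value[OF h Sba])
  have "h * (h * ?P (z + s *\<^sub>R a + t *\<^sub>R b)) = h * (h * ?Q (z + s' *\<^sub>R a + t' *\<^sub>R b))"
  proof -
    have swap: "z + r *\<^sub>R b + r' *\<^sub>R a = z + r' *\<^sub>R a + r *\<^sub>R b" for r r'
      by (simp add: ac_simps)
    show ?thesis using st(5) st'(5) unfolding swap by linarith
  qed
  then have eq: "?P (z + s *\<^sub>R a + t *\<^sub>R b) = ?Q (z + s' *\<^sub>R a + t' *\<^sub>R b)"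
    using h by simp
  have "dist (?P (z + s *\<^sub>R a + t *\<^sub>R b)) (?P z) < \<epsilon>"
    "dist (?Q (z + s' *\<^sub>R a + t' *\<^sub>R b)) (?Q z) < \<epsilon>"
    using d(2)[OF near] st st' by auto
  then have "dist (?P z) (?Q z) < \<epsilon> + \<epsilon>"
    unfolding eq by (intro dist_triangle_less_add[of "?P z" "?Q (z + s' *\<^sub>R a + t' *\<^sub>R b)"])
      (simp_all add: dist_commute)
  then show False by (simp add: \<epsilon>_def)
qed

section \<open>Charts and smooth functions on a manifold\<close>

text \<open>With the chart fixed, this parametrises the tangent space linearly by the model space,
  while \<open>tangent_space\<close> itself lets the chart vary.\<close>

definition chart_vec ::
  "('m::topological_space, 'e::euclidean_space) chart set \<Rightarrow> 'm set \<Rightarrow> ('m \<Rightarrow> 'e) \<Rightarrow> 'm \<Rightarrow> 'e \<Rightarrow> 'm tangent"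
where
  "chart_vec A U \<phi> p w = (\<lambda>f. if smooth_fun_near A p f
     then frechet_derivative (\<lambda>x. f (inv_into U \<phi> x)) (at (\<phi> p)) w else 0)"

text \<open>Continuity at \<open>p\<close> is a separate clause: the coordinate expression has a
  meaning near \<open>p\<close> only if \<open>F\<close> carries a neighbourhood of \<open>p\<close>
  into the chart at \<open>F p\<close>.\<close>

definition smooth_map_near ::
  "('m::topological_space, 'e::euclidean_space) chart set \<Rightarrow> ('m \<Rightarrow> 'm) \<Rightarrow> 'm \<Rightarrow> bool" where
  "smooth_map_near A F p \<longleftrightarrow> filterlim F (nhds (F p)) (nhds p) \<and>
     (\<forall>U \<phi> V \<psi>. (U, \<phi>) \<in> A \<longrightarrow> (V, \<psi>) \<in> A \<longrightarrow> p \<in> U \<longrightarrow> F p \<in> V \<longrightarrow>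
        smooth_at (\<lambda>x. \<psi> (F (inv_into U \<phi> x))) (\<phi> p))"

locale smooth_manifold =
  fixes A :: "('m::topological_space, 'e::euclidean_space) chart set"
  assumes atlas: "smooth_atlas A"
begin

lemma chart:
  assumes "(U, \<phi>) \<in> A"
  shows "open U" "open (\<phi> ` U)" "continuous_on U \<phi>" "continuous_on (\<phi> ` U) (inv_into U \<phi>)"
    "\<And>p. p \<in> U \<Longrightarrow> inv_into U \<phi> (\<phi> p) = p"
proof -
  have "is_chart (U, \<phi>)" using assms atlas unfolding smooth_atlas_def by blast
  then show "open U" "open (\<phi> ` U)" "continuous_on U \<phi>" "continuous_on (\<phi> ` U) (inv_into U \<phi>)"
    "\<And>p. p \<in> U \<Longrightarrow> inv_into U \<phi> (\<phi> p) = p"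
    unfolding is_chart_def homeomorphism_def by auto
qed

lemma chart_at:
  obtains U \<phi> where "(U, \<phi>) \<in> A" "p \<in> U"
proof -
  have "p \<in> (\<Union>c\<in>A. fst c)" using atlas unfolding smooth_atlas_def by blast
  then show ?thesis using that by auto
qed

lemma open_chart_image:
  assumes "(U, \<phi>) \<in> A" "open W"
  shows "open (\<phi> ` (U \<inter> W))"
proof -
  have "\<phi> ` (U \<inter> W) = \<phi> ` U \<inter> inv_into U \<phi> -` W"
    using chart(5)[OF assms(1)] by force
  then show ?thesis
    using continuous_open_preimage[OF chart(4)[OF assms(1)] chart(2)[OF assms(1)] assms(2)] by simp
qed

lemma chart_tendsto:
  assumes "(U, \<phi>) \<in> A" "p \<in> U"
  shows "filterlim \<phi> (nhds (\<phi> p)) (nhds p)"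
    and "filterlim (inv_into U \<phi>) (nhds p) (nhds (\<phi> p))"
proof -
  note c = chart[OF assms(1)]
  have "(\<phi> \<longlongrightarrow> \<phi> p) (at p within U)"
    using c(3) assms(2) unfolding continuous_on_def by blast
  then show "filterlim \<phi> (nhds (\<phi> p)) (nhds p)"
    using at_within_open[OF assms(2) c(1)] tendsto_at_iff_tendsto_nhds[of \<phi> p] by simp
  have "\<phi> p \<in> \<phi> ` U" using assms(2) by simp
  then have "(inv_into U \<phi> \<longlongrightarrow> inv_into U \<phi> (\<phi> p)) (at (\<phi> p))"
    using c(4) at_within_open[OF _ c(2)] unfolding continuous_on_def by metis
  then show "filterlim (inv_into U \<phi>) (nhds p) (nhds (\<phi> p))"
    using tendsto_at_iff_tendsto_nhds[of "inv_into U \<phi>" "\<phi> p"] c(5)[OF assms(2)] by simp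
qed

lemma eventually_chart:
  assumes "(U, \<phi>) \<in> A" "p \<in> U" "\<forall>\<^sub>F q in nhds p. P q"
  shows "\<forall>\<^sub>F x in nhds (\<phi> p). P (inv_into U \<phi> x)"
  using chart_tendsto(2)[OF assms(1,2)] assms(3) unfolding filterlim_iff by blast

lemma eventually_in_chart:
  assumes "(U, \<phi>) \<in> A" "p \<in> U"
  shows "\<forall>\<^sub>F q in nhds p. q \<in> U"
  using chart(1)[OF assms(1)] assms(2) by (rule eventually_nhds_in_open)

lemma transition_smooth_at:
  assumes "(U, \<phi>) \<in> A" "(V, \<psi>) \<in> A" "p \<in> U" "p \<in> V"
  shows "smooth_at (\<lambda>x. \<psi> (inv_into U \<phi> x)) (\<phi> p)"
proof -
  have "smooth_on (\<phi> ` (U \<inter> V)) (\<psi> \<circ> inv_into U \<phi>)"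
    using atlas assms(1,2) unfolding smooth_atlas_def by blast
  then have "smooth_at (\<psi> \<circ> inv_into U \<phi>) (\<phi> p)"
    using open_chart_image[OF assms(1) chart(1)[OF assms(2)]] assms(3,4)
    by (intro smooth_on_imp_smooth_at) auto
  then show ?thesis by (simp add: o_def)
qed

lemma smooth_fun_on_imp_smooth_at:
  assumes "smooth_fun_on A W f" "open W" "p \<in> W" "(U, \<phi>) \<in> A" "p \<in> U"
  shows "smooth_at (\<lambda>x. f (inv_into U \<phi> x)) (\<phi> p)"
proof -
  have "smooth_on (\<phi> ` {p \<in> U \<inter> W. f p \<in> UNIV}) (id \<circ> f \<circ> inv_into U \<phi>)"
    using assms(1,4) unfolding smooth_map_on_def by blast
  then have "smooth_on (\<phi> ` (U \<inter> W)) (\<lambda>x. f (inv_into U \<phi> x))"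
    by (simp add: o_def Int_def)
  then show ?thesis
    using open_chart_image[OF assms(4,2)] assms(3,5) by (intro smooth_on_imp_smooth_at) auto
qed

text \<open>One chart about each point is enough, because the transition maps carry smoothness to
  all other charts.\<close>

lemma smooth_fun_on_if_smooth_at:
  assumes W: "open W"
    and f: "\<And>p. p \<in> W \<Longrightarrow> \<exists>U \<phi>. (U, \<phi>) \<in> A \<and> p \<in> U \<and> smooth_at (\<lambda>x. f (inv_into U \<phi> x)) (\<phi> p)"
  shows "smooth_fun_on A W f"
  unfolding smooth_map_on_def
proof (intro conjI ballI, safe)
  have "(f \<longlongrightarrow> f p) (at p within W)" if p: "p \<in> W" for p
  proof -
    obtain U \<phi> where U: "(U, \<phi>) \<in> A" "p \<in> U" and s: "smooth_at (\<lambda>x. f (inv_into U \<phi> x)) (\<phi> p)"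
      using f[OF p] by blast
    note c = chart[OF U(1)]
    have "((\<lambda>x. f (inv_into U \<phi> x)) \<longlongrightarrow> f p) (nhds (\<phi> p))"
      using smooth_at_isCont[OF s] c(5)[OF U(2)] unfolding isCont_def
      using tendsto_at_iff_tendsto_nhds[of "\<lambda>x. f (inv_into U \<phi> x)" "\<phi> p"] by simp
    then have "((\<lambda>q. f (inv_into U \<phi> (\<phi> q))) \<longlongrightarrow> f p) (nhds p)"
      using chart_tendsto(1)[OF U] by (rule filterlim_compose)
    moreover have "\<forall>\<^sub>F q in nhds p. f (inv_into U \<phi> (\<phi> q)) = f q"
      using eventually_in_chart[OF U] by eventually_elim (simp add: c(5))
    ultimately have "(f \<longlongrightarrow> f p) (nhds p)"
      by (rule Lim_transform_eventually)
    then show ?thesis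
      using tendsto_mono[of "at p within W" "nhds p"] by (simp add: at_within_def)
  qed
  then show "continuous_on W f" unfolding continuous_on_def by blast
next
  fix V \<psi> assume V: "(V, \<psi>) \<in> A"
  have "smooth_at (\<lambda>x. f (inv_into V \<psi> x)) (\<psi> p)" if p: "p \<in> V" "p \<in> W" for p
  proof -
    obtain U \<phi> where U: "(U, \<phi>) \<in> A" "p \<in> U" and s: "smooth_at (\<lambda>x. f (inv_into U \<phi> x)) (\<phi> p)"
      using f[OF p(2)] by blast
    have "smooth_at (\<lambda>x. f (inv_into U \<phi> (\<phi> (inv_into V \<psi> x)))) (\<psi> p)"
      using s chart(5)[OF V p(1)]
      by (intro smooth_at_compose[OF transition_smooth_at[OF V U(1) p(1) U(2)]]) simp
    moreover have "\<forall>\<^sub>F x in nhds (\<psi> p). f (inv_into U \<phi> (\<phi> (inv_into V \<psi> x))) = f (inv_into V \<psi> x)"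
      using eventually_chart[OF V p(1) eventually_in_chart[OF U]]
      by eventually_elim (simp add: chart(5)[OF U(1)])
    ultimately show ?thesis by (rule smooth_at_cong[rotated])
  qed
  then show "smooth_on (\<psi> ` {p \<in> V \<inter> W. f p \<in> UNIV}) (id \<circ> f \<circ> inv_into V \<psi>)"
    by (intro smooth_on_if_smooth_at) (auto simp: o_def)
qed

text \<open>A neighbourhood of \<open>\<phi> p\<close> pulls back to an open set about
  \<open>p\<close>, so any single chart decides smoothness. Through this lemma the rules for
  \<open>smooth_at\<close> become rules for functions on the manifold.\<close>

lemma smooth_fun_near_iff:
  assumes "(U, \<phi>) \<in> A" "p \<in> U"
  shows "smooth_fun_near A p f \<longleftrightarrow> smooth_at (\<lambda>x. f (inv_into U \<phi> x)) (\<phi> p)"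
proof
  show "smooth_fun_near A p f \<Longrightarrow> smooth_at (\<lambda>x. f (inv_into U \<phi> x)) (\<phi> p)"
    using smooth_fun_on_imp_smooth_at assms unfolding smooth_fun_near_def by blast
next
  assume "smooth_at (\<lambda>x. f (inv_into U \<phi> x)) (\<phi> p)"
  then obtain N where N: "open N" "\<phi> p \<in> N" "smooth_on N (\<lambda>x. f (inv_into U \<phi> x))"
    unfolding smooth_at_def by blast
  let ?W = "U \<inter> \<phi> -` N"
  have W: "open ?W"
    using continuous_open_preimage chart(1,3)[OF assms(1)] N(1) by blast
  have "smooth_fun_on A ?W f"
    using assms(1) N by (intro smooth_fun_on_if_smooth_at W) (auto intro: smooth_on_imp_smooth_at)
  then show "smooth_fun_near A p f"
    using W N(2) assms(2) unfolding smooth_fun_near_def by blast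
qed

lemma smooth_fun_on_iff:
  assumes "open W"
  shows "smooth_fun_on A W f \<longleftrightarrow> (\<forall>p\<in>W. smooth_fun_near A p f)"
proof
  show "smooth_fun_on A W f \<Longrightarrow> \<forall>p\<in>W. smooth_fun_near A p f"
    using assms unfolding smooth_fun_near_def by blast
  assume "\<forall>p\<in>W. smooth_fun_near A p f"
  then show "smooth_fun_on A W f"
    using smooth_fun_near_iff by (intro smooth_fun_on_if_smooth_at assms) (metis chart_at)
qed

lemma smooth_fun_near_eventually:
  "smooth_fun_near A p f \<Longrightarrow> \<forall>\<^sub>F q in nhds p. smooth_fun_near A q f"
  unfolding smooth_fun_near_def eventually_nhds by blast

lemma smooth_fun_near_cong:
  assumes "\<forall>\<^sub>F q in nhds p. f q = g q" "smooth_fun_near A p f"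
  shows "smooth_fun_near A p g"
proof -
  obtain U \<phi> where U: "(U, \<phi>) \<in> A" "p \<in> U" by (rule chart_at)
  show ?thesis
    using assms(2) smooth_at_cong[OF eventually_chart[OF U assms(1)]]
    unfolding smooth_fun_near_iff[OF U] by blast
qed

lemma smooth_fun_near_const: "smooth_fun_near A p (\<lambda>q. c)"
  by (rule chart_at[of p]) (simp add: smooth_fun_near_iff smooth_at_const)

lemma smooth_fun_near_add:
  "smooth_fun_near A p f \<Longrightarrow> smooth_fun_near A p g \<Longrightarrow> smooth_fun_near A p (\<lambda>q. f q + g q)"
  by (rule chart_at[of p]) (simp add: smooth_fun_near_iff smooth_at_add)

lemma smooth_fun_near_mult:
  "smooth_fun_near A p f \<Longrightarrow> smooth_fun_near A p g \<Longrightarrow> smooth_fun_near A p (\<lambda>q. f q * g q)"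
  by (rule chart_at[of p]) (use smooth_at_scaleR in \<open>force simp: smooth_fun_near_iff\<close>)

lemma smooth_fun_near_diff:
  assumes "smooth_fun_near A p f" "smooth_fun_near A p g"
  shows "smooth_fun_near A p (\<lambda>q. f q - g q)"
  using smooth_fun_near_add[OF assms(1) smooth_fun_near_mult[OF smooth_fun_near_const[of p "-1"] assms(2)]]
  by simp


section \<open>Tangent vectors\<close>

lemma smooth_map_near_eventually:
  "smooth_map_near A F p \<Longrightarrow> \<forall>\<^sub>F q in nhds (F p). P q \<Longrightarrow> \<forall>\<^sub>F q in nhds p. P (F q)"
  unfolding smooth_map_near_def filterlim_iff by blast

text \<open>This is the chain rule in charts. By continuity of \<open>F\<close>, the composite
  factors near \<open>p\<close> through the chart at \<open>F p\<close>, and germs are all that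
  derivatives see.\<close>

lemma smooth_map_near_fun:
  assumes F: "smooth_map_near A F p" and f: "smooth_fun_near A (F p) f"
  shows "smooth_fun_near A p (\<lambda>q. f (F q))"
    and "\<And>U \<phi> V \<psi>. (U, \<phi>) \<in> A \<Longrightarrow> p \<in> U \<Longrightarrow> (V, \<psi>) \<in> A \<Longrightarrow> F p \<in> V \<Longrightarrow>
      frechet_derivative (\<lambda>x. f (F (inv_into U \<phi> x))) (at (\<phi> p)) w =
      frechet_derivative (\<lambda>y. f (inv_into V \<psi> y)) (at (\<psi> (F p)))
        (frechet_derivative (\<lambda>x. \<psi> (F (inv_into U \<phi> x))) (at (\<phi> p)) w)"
proof -
  have *: "smooth_at (\<lambda>x. f (F (inv_into U \<phi> x))) (\<phi> p) \<and>
      frechet_derivative (\<lambda>x. f (F (inv_into U \<phi> x))) (at (\<phi> p)) w =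
      frechet_derivative (\<lambda>y. f (inv_into V \<psi> y)) (at (\<psi> (F p)))
        (frechet_derivative (\<lambda>x. \<psi> (F (inv_into U \<phi> x))) (at (\<phi> p)) w)"
    if U: "(U, \<phi>) \<in> A" "p \<in> U" and V: "(V, \<psi>) \<in> A" "F p \<in> V" for U \<phi> V \<psi>
  proof -
    let ?K = "\<lambda>x. \<psi> (F (inv_into U \<phi> x))" and ?f = "\<lambda>y. f (inv_into V \<psi> y)"
    have K: "smooth_at ?K (\<phi> p)"
      using F U V unfolding smooth_map_near_def by blast
    have fK: "smooth_at ?f (?K (\<phi> p))"
      using f chart(5)[OF U] unfolding smooth_fun_near_iff[OF V] by simp
    have "\<forall>\<^sub>F q in nhds p. F q \<in> V"
      by (intro smooth_map_near_eventually[OF F] eventually_in_chart[OF V])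
    then have ev: "\<forall>\<^sub>F x in nhds (\<phi> p). ?f (?K x) = f (F (inv_into U \<phi> x))"
      by (rule eventually_mono[OF eventually_chart[OF U]]) (simp add: chart(5)[OF V(1)])
    show ?thesis
      using smooth_at_cong[OF ev smooth_at_compose[OF K fK]]
        frechet_derivative_chain[OF K fK, of w] frechet_derivative_cong_eventually[OF ev]
        chart(5)[OF U] by simp
  qed
  obtain U \<phi> where U: "(U, \<phi>) \<in> A" "p \<in> U" by (rule chart_at)
  obtain V \<psi> where V: "(V, \<psi>) \<in> A" "F p \<in> V" by (rule chart_at)
  show "smooth_fun_near A p (\<lambda>q. f (F q))"
    using *[OF U V] unfolding smooth_fun_near_iff[OF U] by blast
  show "\<And>U \<phi> V \<psi>. (U, \<phi>) \<in> A \<Longrightarrow> p \<in> U \<Longrightarrow> (V, \<psi>) \<in> A \<Longrightarrow> F p \<in> V \<Longrightarrow>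
      frechet_derivative (\<lambda>x. f (F (inv_into U \<phi> x))) (at (\<phi> p)) w =
      frechet_derivative (\<lambda>y. f (inv_into V \<psi> y)) (at (\<psi> (F p)))
        (frechet_derivative (\<lambda>x. \<psi> (F (inv_into U \<phi> x))) (at (\<phi> p)) w)"
    using * by blast
qed

lemma differential_chart_vec:
  assumes "smooth_map_near A F p" "(U, \<phi>) \<in> A" "p \<in> U" "(V, \<psi>) \<in> A" "F p \<in> V"
  shows "differential A F p (chart_vec A U \<phi> p w) =
    chart_vec A V \<psi> (F p) (frechet_derivative (\<lambda>x. \<psi> (F (inv_into U \<phi> x))) (at (\<phi> p)) w)"
  using smooth_map_near_fun[OF assms(1)] assms(2-)
  by (auto simp: fun_eq_iff differential_def chart_vec_def o_def)

lemma smooth_map_near_ident: "smooth_map_near A (\<lambda>q. q) p"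
  using transition_smooth_at unfolding smooth_map_near_def by (simp add: filterlim_ident)

text \<open>A change of charts is the differential of the identity map, so the transformation rule
  for \<open>differential\<close> also turns the coordinate vectors of any other chart into those of
  the given one.\<close>

lemma tangent_space_eq:
  assumes "(U, \<phi>) \<in> A" "p \<in> U"
  shows "tangent_space A p = range (chart_vec A U \<phi> p)"
proof -
  have chart_vec: "(\<lambda>f. if smooth_fun_near A p f
      then frechet_derivative (f \<circ> inv_into V \<psi>) (at (\<psi> p)) w else 0) = chart_vec A V \<psi> p w" for V \<psi> w
    by (auto simp: chart_vec_def o_def)
  have "chart_vec A V \<psi> p w \<in> range (chart_vec A U \<phi> p)" if "(V, \<psi>) \<in> A" "p \<in> V" for V \<psi> w
  proof -
    have "differential A (\<lambda>q. q) p (chart_vec A V \<psi> p w) = chart_vec A V \<psi> p w"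
      by (auto simp: fun_eq_iff differential_def chart_vec_def o_def)
    then show ?thesis
      using differential_chart_vec[OF smooth_map_near_ident that assms, of w] by (metis rangeI)
  qed
  then show ?thesis
    using assms unfolding tangent_space_def chart_vec by auto
qed

lemma differential_tangent_space:
  assumes "smooth_map_near A F p" "v \<in> tangent_space A p"
  shows "differential A F p v \<in> tangent_space A (F p)"
proof -
  obtain U \<phi> where U: "(U, \<phi>) \<in> A" "p \<in> U" by (rule chart_at)
  obtain V \<psi> where V: "(V, \<psi>) \<in> A" "F p \<in> V" by (rule chart_at)
  show ?thesis
    using assms(2) differential_chart_vec[OF assms(1) U V]
    unfolding tangent_space_eq[OF U] tangent_space_eq[OF V] by auto
qed

lemma linear_chart_vec:
  assumes "(U, \<phi>) \<in> A" "p \<in> U"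
  shows "linear (chart_vec A U \<phi> p)"
proof -
  have lin: "linear (frechet_derivative (\<lambda>x. f (inv_into U \<phi> x)) (at (\<phi> p)))"
    if "smooth_fun_near A p f" for f
    using that unfolding smooth_fun_near_iff[OF assms]
    by (intro linear_frechet_derivative smooth_at_differentiable)
  show ?thesis
    by (rule linearI)
      (auto simp: chart_vec_def fun_eq_iff scaleR_fun_def linear_add[OF lin] linear_scale[OF lin])
qed

lemma subspace_tangent_space: "subspace (tangent_space A p)"
proof -
  obtain U \<phi> where U: "(U, \<phi>) \<in> A" "p \<in> U" by (rule chart_at)
  show ?thesis unfolding tangent_space_eq[OF U]
    by (intro linear_subspace_image linear_chart_vec[OF U] subspace_UNIV)
qed

text \<open>Applied to the coordinate functions of the chart, a tangent vector returns its
  components.\<close>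

lemma chart_vec_eq_0D:
  assumes U: "(U, \<phi>) \<in> A" "p \<in> U" and 0: "chart_vec A U \<phi> p w = 0"
  shows "w = 0"
proof (rule euclidean_eqI)
  fix b :: 'e assume "b \<in> Basis"
  let ?f = "\<lambda>q. \<phi> q \<bullet> b"
  have "open (\<phi> ` U)" "\<phi> p \<in> \<phi> ` U" using chart(2)[OF U(1)] U(2) by auto
  then have "\<forall>\<^sub>F x in nhds (\<phi> p). x \<in> \<phi> ` U" by (rule eventually_nhds_in_open)
  then have ev: "\<forall>\<^sub>F x in nhds (\<phi> p). x \<bullet> b = ?f (inv_into U \<phi> x)"
    by eventually_elim (auto simp: chart(5)[OF U(1)])
  have "smooth_at (\<lambda>x. x \<bullet> b) (\<phi> p)"
    by (intro smooth_at_bounded_linear bounded_linear_inner_left)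
  then have s: "smooth_fun_near A p ?f"
    unfolding smooth_fun_near_iff[OF U] by (rule smooth_at_cong[OF ev])
  have "((\<lambda>x. x \<bullet> b) has_derivative (\<lambda>x. x \<bullet> b)) (at (\<phi> p))"
    by (intro bounded_linear_imp_has_derivative bounded_linear_inner_left)
  then have "(\<lambda>x. x \<bullet> b) = frechet_derivative (\<lambda>x. x \<bullet> b) (at (\<phi> p))"
    by (rule frechet_derivative_at)
  also have "\<dots> = frechet_derivative (\<lambda>x. ?f (inv_into U \<phi> x)) (at (\<phi> p))"
    by (rule frechet_derivative_cong_eventually[OF ev])
  finally have "w \<bullet> b = frechet_derivative (\<lambda>x. ?f (inv_into U \<phi> x)) (at (\<phi> p)) w"
    by (rule fun_cong)
  then have "w \<bullet> b = chart_vec A U \<phi> p w ?f"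
    using s by (simp only: chart_vec_def if_True)
  then show "w \<bullet> b = 0 \<bullet> b" using 0 by simp
qed

text \<open>A tangent vector is a derivation on germs. The bracket identities rest on these rules
  and not on coordinates; the first rule takes care of the dummy value.\<close>

lemma
  assumes "v \<in> tangent_space A p"
  shows tangent_nonsmooth: "\<not> smooth_fun_near A p f \<Longrightarrow> v f = 0"
    and tangent_cong: "\<forall>\<^sub>F q in nhds p. f q = g q \<Longrightarrow> v f = v g"
    and tangent_const: "v (\<lambda>q. r) = 0"
    and tangent_add: "smooth_fun_near A p f \<Longrightarrow> smooth_fun_near A p g \<Longrightarrow>
      v (\<lambda>q. f q + g q) = v f + v g"
    and tangent_mult: "smooth_fun_near A p f \<Longrightarrow> smooth_fun_near A p g \<Longrightarrow>
      v (\<lambda>q. f q * g q) = f p * v g + v f * g p"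
proof -
  obtain U \<phi> where U: "(U, \<phi>) \<in> A" "p \<in> U" by (rule chart_at)
  obtain w where v: "v = chart_vec A U \<phi> p w"
    using assms unfolding tangent_space_eq[OF U] by blast
  note d = smooth_at_has_derivative[OF smooth_fun_near_iff[OF U, THEN iffD1]]
  show "\<not> smooth_fun_near A p f \<Longrightarrow> v f = 0" by (simp add: v chart_vec_def)
  show "v f = v g" if ev: "\<forall>\<^sub>F q in nhds p. f q = g q"
  proof -
    have "\<forall>\<^sub>F q in nhds p. g q = f q" using ev by eventually_elim simp
    then have "smooth_fun_near A p f \<longleftrightarrow> smooth_fun_near A p g"
      using smooth_fun_near_cong[OF ev] smooth_fun_near_cong[of g f p] by blast
    then show ?thesis
      using frechet_derivative_cong_eventually[OF eventually_chart[OF U ev]]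
      by (simp add: v chart_vec_def)
  qed
  show "v (\<lambda>q. r) = 0" by (simp add: v chart_vec_def)
  assume f: "smooth_fun_near A p f" and g: "smooth_fun_near A p g"
  show "v (\<lambda>q. f q + g q) = v f + v g"
    using frechet_derivative_at[OF has_derivative_add[OF d[OF f] d[OF g]], symmetric]
    by (simp add: v chart_vec_def f g smooth_fun_near_add)
  show "v (\<lambda>q. f q * g q) = f p * v g + v f * g p"
    using frechet_derivative_at[OF has_derivative_mult[OF d[OF f] d[OF g]], symmetric]
    by (simp add: v chart_vec_def f g smooth_fun_near_mult chart(5)[OF U])
qed

lemma tangent_diff:
  assumes "v \<in> tangent_space A p" "smooth_fun_near A p f" "smooth_fun_near A p g"
  shows "v (\<lambda>q. f q - g q) = v f - v g"
proof -
  have "v (\<lambda>q. (f q - g q) + g q) = v (\<lambda>q. f q - g q) + v g"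
    using assms by (intro tangent_add smooth_fun_near_diff)
  then show ?thesis by simp
qed


section \<open>Vector fields\<close>

lemma vector_field_tangent: "vector_field A X \<Longrightarrow> X p \<in> tangent_space A p"
  unfolding vector_field_def by blast

lemma vector_field_smooth:
  "vector_field A X \<Longrightarrow> smooth_fun_near A p f \<Longrightarrow> smooth_fun_near A p (\<lambda>q. X q f)"
  unfolding vector_field_def smooth_fun_near_def by blast

lemma vector_fieldI:
  assumes "\<And>p. X p \<in> tangent_space A p"
    and "\<And>p f. smooth_fun_near A p f \<Longrightarrow> smooth_fun_near A p (\<lambda>q. X q f)"
  shows "vector_field A X"
  using assms unfolding vector_field_def by (auto simp: smooth_fun_on_iff)

lemma vector_field_zero: "vector_field A 0"
  by (intro vector_fieldI)
    (simp_all add: subspace_0 subspace_tangent_space smooth_fun_near_const)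

lemma vector_field_add: "vector_field A X \<Longrightarrow> vector_field A Y \<Longrightarrow> vector_field A (X + Y)"
  by (intro vector_fieldI)
    (simp_all add: subspace_add subspace_tangent_space vector_field_tangent
      smooth_fun_near_add vector_field_smooth)

lemma vector_field_mult:
  assumes "smooth_fun_on A UNIV h" "vector_field A X"
  shows "vector_field A (mult_field h X)"
proof (rule vector_fieldI)
  show "mult_field h X p \<in> tangent_space A p" for p
    using assms(2) by (simp add: mult_field_def subspace_scale subspace_tangent_space vector_field_tangent)
  show "smooth_fun_near A p (\<lambda>q. mult_field h X q f)" if "smooth_fun_near A p f" for p f
    using assms that
    by (simp add: mult_field_def scaleR_fun_def smooth_fun_on_iff smooth_fun_near_mult vector_field_smooth)
qed

lemma mult_field_const: "mult_field (\<lambda>p. r) X = r *\<^sub>R X"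
  by (simp add: mult_field_def fun_eq_iff scaleR_fun_def)

lemma vector_field_scaleR: "vector_field A X \<Longrightarrow> vector_field A (r *\<^sub>R X)"
  using vector_field_mult[of "\<lambda>p. r" X] by (simp add: mult_field_const smooth_fun_on_iff smooth_fun_near_const)

lemma vector_field_diff: "vector_field A X \<Longrightarrow> vector_field A Y \<Longrightarrow> vector_field A (X - Y)"
  using vector_field_add[of X "(-1) *\<^sub>R Y"] vector_field_scaleR[of Y "-1"] by simp

lemma vector_field_sum:
  "(\<And>i. i \<in> I \<Longrightarrow> vector_field A (X i)) \<Longrightarrow> vector_field A (sum X I)"
  by (induction I rule: infinite_finite_induct) (auto simp: vector_field_zero vector_field_add)

section \<open>Lie brackets of vector fields\<close>

lemma lie_bracket_commute: "lie_bracket A X Y = - lie_bracket A Y X"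
  by (auto simp: lie_bracket_def fun_eq_iff)

lemma lie_bracket_add:
  assumes "vector_field A X" "vector_field A Y" "vector_field A Z"
  shows "lie_bracket A (X + Y) Z = lie_bracket A X Z + lie_bracket A Y Z"
  using assms
  by (auto simp: lie_bracket_def fun_eq_iff tangent_add[OF vector_field_tangent[OF assms(3)]] vector_field_smooth)

lemma lie_bracket_mult:
  assumes h: "smooth_fun_on A UNIV h" and "vector_field A X" "vector_field A Y"
  shows "lie_bracket A (mult_field h X) Y =
    mult_field h (lie_bracket A X Y) - mult_field (\<lambda>p. Y p h) X"
proof -
  have "smooth_fun_near A p h" for p using h by (simp add: smooth_fun_on_iff)
  \<comment> \<open>If \<open>f\<close> is not smooth near \<open>p\<close>, both brackets are zero
    by definition and the correction term vanishes because \<open>X p\<close> is a tangent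
    vector.\<close>
  then show ?thesis
    using assms(2-) tangent_nonsmooth[OF vector_field_tangent[OF assms(2)]]
    by (auto simp: lie_bracket_def fun_eq_iff mult_field_def scaleR_fun_def algebra_simps
        tangent_mult[OF vector_field_tangent[OF assms(3)]] vector_field_smooth)
qed

lemma jacobi:
  assumes X: "vector_field A X" and Y: "vector_field A Y" and Z: "vector_field A Z"
  shows "lie_bracket A X (lie_bracket A Y Z) =
    lie_bracket A (lie_bracket A X Y) Z + lie_bracket A Y (lie_bracket A X Z)"
proof -
  have "U p (\<lambda>q. lie_bracket A V W q f) = U p (\<lambda>q. V q (\<lambda>r. W r f)) - U p (\<lambda>q. W q (\<lambda>r. V r f))"
    if UVW: "vector_field A U" "vector_field A V" "vector_field A W" and f: "smooth_fun_near A p f"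
    for U V W p f
  proof -
    have "\<forall>\<^sub>F q in nhds p. lie_bracket A V W q f = V q (\<lambda>r. W r f) - W q (\<lambda>r. V r f)"
      using smooth_fun_near_eventually[OF f] by eventually_elim (simp add: lie_bracket_def)
    \<comment> \<open>The formula for the inner bracket holds only where \<open>f\<close> is smooth,
      hence only near \<open>p\<close>; a tangent vector at \<open>p\<close> does not see the
      difference.\<close>
    then have "U p (\<lambda>q. lie_bracket A V W q f) = U p (\<lambda>q. V q (\<lambda>r. W r f) - W q (\<lambda>r. V r f))"
      by (rule tangent_cong[OF vector_field_tangent[OF UVW(1)]])
    then show ?thesis
      using f UVW by (simp add: tangent_diff[OF vector_field_tangent[OF UVW(1)]] vector_field_smooth)
  qed
  note inner = this
  have br: "lie_bracket A U V p f = U p (\<lambda>q. V q f) - V p (\<lambda>q. U q f)"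
    if "smooth_fun_near A p f" for U V p f
    using that by (simp add: lie_bracket_def)
  show ?thesis
  proof (intro ext)
    fix p f
    show "lie_bracket A X (lie_bracket A Y Z) p f =
      (lie_bracket A (lie_bracket A X Y) Z + lie_bracket A Y (lie_bracket A X Z)) p f"
    proof (cases "smooth_fun_near A p f")
      case True
      with X Y Z show ?thesis by (simp add: br inner vector_field_smooth)
    next
      case False
      then show ?thesis by (simp add: lie_bracket_def)
    qed
  qed
qed

end

section \<open>Invariant vector fields on a Lie group\<close>

sublocale lie_group \<subseteq> smooth_manifold A
  by unfold_locales (rule smooth_atlas)

context lie_group
begin

text \<open>The product atlas speaks of the inverse of \<open>map_prod \<phi> \<psi>\<close>. On the
  image of \<open>U \<times> V\<close> injectivity identifies it with the pair of inverses, and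
  continuity of the multiplication makes the domain of the coordinate expression open.\<close>

lemma mul_smooth_at:
  assumes U: "(U, \<phi>) \<in> A" "a \<in> U" and V: "(V, \<psi>) \<in> A" "b \<in> V" and W: "(W, \<zeta>) \<in> A" "mul a b \<in> W"
  shows "smooth_at (\<lambda>z. \<zeta> (mul (inv_into U \<phi> (fst z)) (inv_into V \<psi> (snd z)))) (\<phi> a, \<psi> b)"
proof -
  let ?m = "\<lambda>(a, p). mul a p"
  let ?\<Phi> = "map_prod \<phi> \<psi>"
  let ?\<iota> = "\<lambda>z. (inv_into U \<phi> (fst z), inv_into V \<psi> (snd z))"
  let ?S = "?\<Phi> ` {r \<in> (U \<times> V) \<inter> UNIV. ?m r \<in> W}"
  have cont: "continuous_on UNIV ?m"
    using smooth_mul unfolding smooth_map_on_def by blast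
  have "(U \<times> V, ?\<Phi>) \<in> prod_atlas A A"
    using U(1) V(1) unfolding prod_atlas_def by blast
  then have smooth: "smooth_on ?S (\<zeta> \<circ> ?m \<circ> inv_into (U \<times> V) ?\<Phi>)"
    using smooth_mul W(1) unfolding smooth_map_on_def by blast
  have inv: "?\<iota> (?\<Phi> r) = r" if "r \<in> U \<times> V" for r
    using that chart(5)[OF U(1)] chart(5)[OF V(1)] by (cases r) simp
  then have inj: "inj_on ?\<Phi> (U \<times> V)" by (rule inj_on_inverseI[of _ ?\<iota>])
  have eq: "(\<zeta> \<circ> ?m \<circ> inv_into (U \<times> V) ?\<Phi>) z = \<zeta> (mul (inv_into U \<phi> (fst z)) (inv_into V \<psi> (snd z)))"
    if "z \<in> ?S" for z
  proof -
    from that have "z \<in> ?\<Phi> ` (U \<times> V)" by (rule rev_subsetD) (intro image_mono, simp add: subset_iff)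
    then obtain r where z: "z = ?\<Phi> r" and r: "r \<in> U \<times> V" by (rule imageE)
    have "inv_into (U \<times> V) ?\<Phi> z = ?\<iota> z"
      unfolding z inv[OF r] by (rule inv_into_f_f[OF inj r])
    then show ?thesis by simp
  qed
  have "continuous_on (\<phi> ` U \<times> \<psi> ` V) ?\<iota>"
    by (intro continuous_on_Pair continuous_on_compose2[OF chart(4)[OF U(1)]]
        continuous_on_compose2[OF chart(4)[OF V(1)]] continuous_on_fst continuous_on_snd continuous_on_id) auto
  then have "continuous_on (\<phi> ` U \<times> \<psi> ` V) (\<lambda>z. ?m (?\<iota> z))"
    by (rule continuous_on_compose2[OF cont]) simp
  then have "open ((\<phi> ` U \<times> \<psi> ` V) \<inter> (\<lambda>z. ?m (?\<iota> z)) -` W)"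
    by (intro continuous_open_preimage open_Times chart(2)[OF U(1)] chart(2)[OF V(1)] chart(1)[OF W(1)])
  moreover have "?S = (\<phi> ` U \<times> \<psi> ` V) \<inter> (\<lambda>z. ?m (?\<iota> z)) -` W"
    using inv by (force simp: chart(5)[OF U(1)] chart(5)[OF V(1)])
  ultimately have S: "open ?S" by simp
  have z: "(\<phi> a, \<psi> b) \<in> ?S" using U(2) V(2) W(2) by force
  show ?thesis
    by (rule smooth_at_cong[OF eventually_mono[OF eventually_nhds_in_open[OF S z] eq]
          smooth_on_imp_smooth_at[OF smooth S z]])
qed

lemma mul_tendsto: "filterlim (\<lambda>(a, p). mul a p) (nhds (mul a b)) (nhds (a, b))"
proof -
  have "continuous_on UNIV (\<lambda>(a, p). mul a p)"
    using smooth_mul unfolding smooth_map_on_def by blast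
  then have "isCont (\<lambda>(a, p). mul a p) (a, b)" by (simp add: continuous_on_eq_continuous_at)
  then show ?thesis
    unfolding isCont_def using tendsto_at_iff_tendsto_nhds[of "\<lambda>(a, p). mul a p" "(a, b)"] by simp
qed

lemma smooth_left_mul: "smooth_map_near A (mul a) p"
  unfolding smooth_map_near_def
proof (intro conjI allI impI)
  have "filterlim (\<lambda>q. (a, q)) (nhds (a, p)) (nhds p)"
    by (intro tendsto_Pair tendsto_const filterlim_ident)
  from filterlim_compose[OF mul_tendsto this]
  show "filterlim (mul a) (nhds (mul a p)) (nhds p)" by simp
  fix V \<psi> W \<zeta> assume V: "(V, \<psi>) \<in> A" "p \<in> V" and W: "(W, \<zeta>) \<in> A" "mul a p \<in> W"
  obtain U \<phi> where U: "(U, \<phi>) \<in> A" "a \<in> U" by (rule chart_at)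
  show "smooth_at (\<lambda>x. \<zeta> (mul a (inv_into V \<psi> x))) (\<psi> p)"
    using smooth_at_slice_snd(1)[OF mul_smooth_at[OF U V W]] chart(5)[OF U] by simp
qed

lemma smooth_right_mul: "smooth_map_near A (\<lambda>h. mul h a) p"
  unfolding smooth_map_near_def
proof (intro conjI allI impI)
  have "filterlim (\<lambda>q. (q, a)) (nhds (p, a)) (nhds p)"
    by (intro tendsto_Pair tendsto_const filterlim_ident)
  from filterlim_compose[OF mul_tendsto this]
  show "filterlim (\<lambda>h. mul h a) (nhds (mul p a)) (nhds p)" by simp
  fix V \<psi> W \<zeta> assume V: "(V, \<psi>) \<in> A" "p \<in> V" and W: "(W, \<zeta>) \<in> A" "mul p a \<in> W"
  obtain U \<phi> where U: "(U, \<phi>) \<in> A" "a \<in> U" by (rule chart_at)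
  show "smooth_at (\<lambda>x. \<zeta> (mul (inv_into V \<psi> x) a)) (\<psi> p)"
    using smooth_at_slice_fst(1)[OF mul_smooth_at[OF V U W]] chart(5)[OF U] by simp
qed

text \<open>The partial derivatives of this function of two variables are the values on
  \<open>f\<close> of left and right invariant fields.\<close>

lemma fun_mul_smooth_at:
  assumes U: "(U, \<phi>) \<in> A" "a \<in> U" and V: "(V, \<psi>) \<in> A" "b \<in> V" and f: "smooth_fun_near A (mul a b) f"
  shows "smooth_at (\<lambda>z. f (mul (inv_into U \<phi> (fst z)) (inv_into V \<psi> (snd z)))) (\<phi> a, \<psi> b)"
proof -
  obtain W \<zeta> where W: "(W, \<zeta>) \<in> A" "mul a b \<in> W" by (rule chart_at)
  have lim: "filterlim (\<lambda>z. mul (inv_into U \<phi> (fst z)) (inv_into V \<psi> (snd z))) (nhds (mul a b)) (nhds (\<phi> a, \<psi> b))"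
  proof -
    have "filterlim fst (nhds (\<phi> a)) (nhds (\<phi> a, \<psi> b))" "filterlim snd (nhds (\<psi> b)) (nhds (\<phi> a, \<psi> b))"
      using tendsto_fst[OF filterlim_ident[of "nhds (\<phi> a, \<psi> b)"]]
        tendsto_snd[OF filterlim_ident[of "nhds (\<phi> a, \<psi> b)"]] by simp_all
    then have "filterlim (\<lambda>z. (inv_into U \<phi> (fst z), inv_into V \<psi> (snd z))) (nhds (a, b)) (nhds (\<phi> a, \<psi> b))"
      by (intro tendsto_Pair filterlim_compose[OF chart_tendsto(2)[OF U]]
          filterlim_compose[OF chart_tendsto(2)[OF V]])
    from filterlim_compose[OF mul_tendsto this] show ?thesis by simp
  qed
  have "\<forall>\<^sub>F z in nhds (\<phi> a, \<psi> b). mul (inv_into U \<phi> (fst z)) (inv_into V \<psi> (snd z)) \<in> W"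
    using lim eventually_in_chart[OF W] unfolding filterlim_iff by blast
  then have ev: "\<forall>\<^sub>F z in nhds (\<phi> a, \<psi> b).
      f (inv_into W \<zeta> (\<zeta> (mul (inv_into U \<phi> (fst z)) (inv_into V \<psi> (snd z))))) =
      f (mul (inv_into U \<phi> (fst z)) (inv_into V \<psi> (snd z)))"
    by eventually_elim (simp add: chart(5)[OF W(1)])
  show ?thesis
    using f unfolding smooth_fun_near_iff[OF W]
    by (intro smooth_at_cong[OF ev] smooth_at_compose[OF mul_smooth_at[OF U V W]])
      (simp add: chart(5)[OF U] chart(5)[OF V])
qed

section \<open>Fields generated by a tangent vector at the identity\<close>

definition left_field :: "'g tangent \<Rightarrow> 'g vfield" where
  "left_field v = (\<lambda>q. differential A (mul q) e v)"

definition right_field :: "'g tangent \<Rightarrow> 'g vfield" where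
  "right_field v = (\<lambda>q. differential A (\<lambda>h. mul h q) e v)"

lemma left_field_tangent: "v \<in> tangent_space A e \<Longrightarrow> left_field v q \<in> tangent_space A q"
  using differential_tangent_space[OF smooth_left_mul, of v e q] by (simp add: left_field_def)

lemma right_field_tangent: "v \<in> tangent_space A e \<Longrightarrow> right_field v q \<in> tangent_space A q"
  using differential_tangent_space[OF smooth_right_mul, of v e q] by (simp add: right_field_def)

lemma left_field_apply:
  assumes "(V, \<psi>) \<in> A" "e \<in> V" "smooth_fun_near A q f"
  shows "left_field (chart_vec A V \<psi> e w) q f =
    frechet_derivative (\<lambda>y. f (mul q (inv_into V \<psi> y))) (at (\<psi> e)) w"
  using assms smooth_map_near_fun(1)[OF smooth_left_mul, of q e f]
  by (simp add: left_field_def differential_def chart_vec_def o_def)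

lemma right_field_apply:
  assumes "(V, \<psi>) \<in> A" "e \<in> V" "smooth_fun_near A q f"
  shows "right_field (chart_vec A V \<psi> e w) q f =
    frechet_derivative (\<lambda>y. f (mul (inv_into V \<psi> y) q)) (at (\<psi> e)) w"
  using assms smooth_map_near_fun(1)[OF smooth_right_mul, of e q f]
  by (simp add: right_field_def differential_def chart_vec_def o_def)

lemma tendsto_Pair_const:
  "filterlim (\<lambda>x. (x, b)) (nhds (a, b)) (nhds a)" "filterlim (\<lambda>y. (a, y)) (nhds (a, b)) (nhds b)"
  by (intro tendsto_Pair tendsto_const filterlim_ident)+

text \<open>The value on \<open>f\<close> at \<open>q\<close> is a partial derivative, in the second
  factor at the identity, of the smooth function \<open>f (q h)\<close> of two variables; so it
  depends smoothly on \<open>q\<close>.\<close>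

lemma vector_field_left_field:
  assumes v: "v \<in> tangent_space A e"
  shows "vector_field A (left_field v)"
proof (rule vector_fieldI)
  fix q f assume f: "smooth_fun_near A q f"
  obtain U \<phi> where U: "(U, \<phi>) \<in> A" "q \<in> U" by (rule chart_at)
  obtain V \<psi> where V: "(V, \<psi>) \<in> A" "e \<in> V" by (rule chart_at)
  obtain w where w: "v = chart_vec A V \<psi> e w" using v unfolding tangent_space_eq[OF V] by blast
  let ?G = "\<lambda>z. f (mul (inv_into U \<phi> (fst z)) (inv_into V \<psi> (snd z)))"
  have G: "smooth_at ?G (\<phi> q, \<psi> e)"
    using f by (intro fun_mul_smooth_at U V) simp
  have "\<forall>\<^sub>F x in nhds (\<phi> q). smooth_at ?G (x, \<psi> e)"
    using tendsto_Pair_const(1)[of "\<psi> e" "\<phi> q"] smooth_at_eventually[OF G] unfolding filterlim_iff by blast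
  then have ev: "\<forall>\<^sub>F x in nhds (\<phi> q).
      frechet_derivative ?G (at (x, \<psi> e)) (0, w) = left_field v (inv_into U \<phi> x) f"
    using eventually_chart[OF U smooth_fun_near_eventually[OF f]]
  proof eventually_elim
    case (elim x)
    show ?case
      using smooth_at_slice_snd(2)[OF elim(1), of w] left_field_apply[OF V elim(2), of w] by (simp add: w)
  qed
  have "smooth_at (\<lambda>x. frechet_derivative ?G (at (x, \<psi> e)) (0, w)) (\<phi> q)"
    using smooth_at_slice_fst(1)[OF smooth_at_frechet_derivative[OF G]] .
  then show "smooth_fun_near A q (\<lambda>q. left_field v q f)"
    unfolding smooth_fun_near_iff[OF U] by (rule smooth_at_cong[OF ev])
qed (rule left_field_tangent[OF v])

lemma vector_field_right_field:
  assumes v: "v \<in> tangent_space A e"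
  shows "vector_field A (right_field v)"
proof (rule vector_fieldI)
  fix q f assume f: "smooth_fun_near A q f"
  obtain U \<phi> where U: "(U, \<phi>) \<in> A" "q \<in> U" by (rule chart_at)
  obtain V \<psi> where V: "(V, \<psi>) \<in> A" "e \<in> V" by (rule chart_at)
  obtain w where w: "v = chart_vec A V \<psi> e w" using v unfolding tangent_space_eq[OF V] by blast
  let ?G = "\<lambda>z. f (mul (inv_into V \<psi> (fst z)) (inv_into U \<phi> (snd z)))"
  have G: "smooth_at ?G (\<psi> e, \<phi> q)"
    using f by (intro fun_mul_smooth_at U V) simp
  have "\<forall>\<^sub>F x in nhds (\<phi> q). smooth_at ?G (\<psi> e, x)"
    using tendsto_Pair_const(2)[of "\<psi> e" "\<phi> q"] smooth_at_eventually[OF G] unfolding filterlim_iff by blast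
  then have ev: "\<forall>\<^sub>F x in nhds (\<phi> q).
      frechet_derivative ?G (at (\<psi> e, x)) (w, 0) = right_field v (inv_into U \<phi> x) f"
    using eventually_chart[OF U smooth_fun_near_eventually[OF f]]
  proof eventually_elim
    case (elim x)
    show ?case
      using smooth_at_slice_fst(2)[OF elim(1), of w] right_field_apply[OF V elim(2), of w] by (simp add: w)
  qed
  have "smooth_at (\<lambda>x. frechet_derivative ?G (at (\<psi> e, x)) (w, 0)) (\<phi> q)"
    using smooth_at_slice_snd(1)[OF smooth_at_frechet_derivative[OF G]] .
  then show "smooth_fun_near A q (\<lambda>q. right_field v q f)"
    unfolding smooth_fun_near_iff[OF U] by (rule smooth_at_cong[OF ev])
qed (rule right_field_tangent[OF v])

lemma left_field_invariant: "left_field v (mul a p) = differential A (mul a) p (left_field v p)"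
  using smooth_map_near_fun(1)[OF smooth_left_mul, of a p]
  by (auto simp: fun_eq_iff left_field_def differential_def o_def assoc)

lemma left_field_at_e: "v \<in> tangent_space A e \<Longrightarrow> left_field v e = v"
  by (auto simp: fun_eq_iff left_field_def differential_def o_def tangent_nonsmooth)

text \<open>Translate \<open>u\<close> back to the identity by \<open>inve p\<close> and spread the
  result out again. Thus every tangent vector extends to a global invariant field.\<close>

lemma tangent_eq_left_field:
  assumes u: "u \<in> tangent_space A p"
  obtains v where "v \<in> tangent_space A e" "left_field v p = u"
proof
  let ?v = "differential A (mul (inve p)) p u"
  show "?v \<in> tangent_space A e"
    using differential_tangent_space[OF smooth_left_mul u, of "inve p"] by simp
  have s: "smooth_fun_near A e (\<lambda>h. f (mul p h))" if "smooth_fun_near A p f" for f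
    using that smooth_map_near_fun(1)[OF smooth_left_mul, of p e f] by simp
  have "mul p (mul (inve p) q) = q" for q by (simp flip: assoc)
  then show "left_field ?v p = u"
    using s tangent_nonsmooth[OF u] by (auto simp: fun_eq_iff left_field_def differential_def o_def)
qed

lemma tangent_eq_right_field:
  assumes u: "u \<in> tangent_space A p"
  obtains v where "v \<in> tangent_space A e" "right_field v p = u"
proof
  let ?v = "differential A (\<lambda>h. mul h (inve p)) p u"
  show "?v \<in> tangent_space A e"
    using differential_tangent_space[OF smooth_right_mul u, of "inve p"] by simp
  have s: "smooth_fun_near A e (\<lambda>h. f (mul h p))" if "smooth_fun_near A p f" for f
    using that smooth_map_near_fun(1)[OF smooth_right_mul, of e p f] by simp
  have "mul (mul q (inve p)) p = q" for q by (simp add: assoc)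
  then show "right_field ?v p = u"
    using s tangent_nonsmooth[OF u] by (auto simp: fun_eq_iff right_field_def differential_def o_def)
qed

lemma left_field_in_lie_algebra: "v \<in> tangent_space A e \<Longrightarrow> left_field v \<in> lie_algebra mul A"
  unfolding lie_algebra_def using vector_field_left_field left_field_invariant by simp

lemma lie_algebra_eq_left_field:
  assumes "X \<in> lie_algebra mul A"
  shows "X = left_field (X e)"
proof
  fix p
  have "X (mul p e) = differential A (mul p) e (X e)"
    using assms unfolding lie_algebra_def by blast
  then show "X p = left_field (X e) p" by (simp add: left_field_def)
qed

lemma lie_algebra_vector_field: "X \<in> lie_algebra mul A \<Longrightarrow> vector_field A X"
  unfolding lie_algebra_def by simp

lemma left_field_add: "left_field (v + w) = left_field v + left_field w"
  by (auto simp: fun_eq_iff left_field_def differential_def)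

lemma left_field_scaleR: "left_field (r *\<^sub>R v) = r *\<^sub>R left_field v"
  by (auto simp: fun_eq_iff left_field_def differential_def scaleR_fun_def)

text \<open>Invariance holds because left translations relate each field to itself. Smoothness of
  the bracket is a hypothesis here; it is supplied later by a torsion-free connection.\<close>

lemma lie_bracket_in_lie_algebra:
  assumes X: "X \<in> lie_algebra mul A" and Y: "Y \<in> lie_algebra mul A"
    and br: "vector_field A (lie_bracket A X Y)"
  shows "lie_bracket A X Y \<in> lie_algebra mul A"
proof -
  have inv: "X (mul a p) (\<lambda>q. Y q f) = X p (\<lambda>q. Y q (f \<circ> mul a))"
    if X: "X \<in> lie_algebra mul A" and Y: "Y \<in> lie_algebra mul A" and f: "smooth_fun_near A (mul a p) f"
    for X Y a p f
  proof -
    have "X (mul a p) (\<lambda>q. Y q f) = X p (\<lambda>q. Y (mul a q) f)"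
      using X vector_field_smooth[OF lie_algebra_vector_field[OF Y] f]
      by (simp add: lie_algebra_def differential_def o_def)
    moreover have "\<forall>\<^sub>F q in nhds p. smooth_fun_near A (mul a q) f"
      by (intro smooth_map_near_eventually[OF smooth_left_mul] smooth_fun_near_eventually[OF f])
    then have "\<forall>\<^sub>F q in nhds p. Y (mul a q) f = Y q (f \<circ> mul a)"
      by (rule eventually_mono) (use Y in \<open>simp add: lie_algebra_def differential_def\<close>)
    then have "X p (\<lambda>q. Y (mul a q) f) = X p (\<lambda>q. Y q (f \<circ> mul a))"
      by (rule tangent_cong[OF vector_field_tangent[OF lie_algebra_vector_field[OF X]]])
    ultimately show ?thesis by simp
  qed
  have "lie_bracket A X Y (mul a p) = differential A (mul a) p (lie_bracket A X Y p)" for a p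
    using inv[OF X Y] inv[OF Y X] smooth_map_near_fun(1)[OF smooth_left_mul, of a p]
    by (auto simp: fun_eq_iff lie_bracket_def differential_def o_def)
  with br show ?thesis by (simp add: lie_algebra_def)
qed

text \<open>By associativity both iterated derivatives are mixed second derivatives of
  \<open>f (h p k)\<close> at \<open>h = k = e\<close>: the left field differentiates in
  \<open>k\<close> and the right field in \<open>h\<close>.\<close>

lemma left_right_commute:
  assumes v: "v \<in> tangent_space A e" and u: "u \<in> tangent_space A e"
  shows "lie_bracket A (left_field v) (right_field u) = 0"
proof -
  have "left_field v p (\<lambda>q. right_field u q f) = right_field u p (\<lambda>q. left_field v q f)"
    if f: "smooth_fun_near A p f" for p f
  proof -
    obtain U \<phi> where U: "(U, \<phi>) \<in> A" "p \<in> U" by (rule chart_at)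
    obtain V \<psi> where V: "(V, \<psi>) \<in> A" "e \<in> V" by (rule chart_at)
    obtain w where w: "v = chart_vec A V \<psi> e w" using v unfolding tangent_space_eq[OF V] by blast
    obtain w' where w': "u = chart_vec A V \<psi> e w'" using u unfolding tangent_space_eq[OF V] by blast
    define \<iota> where "\<iota> = inv_into V \<psi>"
    define \<epsilon> where "\<epsilon> = \<psi> e"
    define H where "H = (\<lambda>z. f (mul (mul (\<iota> (fst z)) p) (\<iota> (snd z))))"
    have H: "smooth_at H (\<epsilon>, \<epsilon>)"
    proof -
      \<comment> \<open>The triple product is treated as the product of \<open>h p\<close>, taken in
        the chart \<open>U\<close>, with \<open>k\<close>, so that smoothness of products of two
        factors suffices. The two expressions agree only while \<open>h p\<close> stays in
        \<open>U\<close>.\<close>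
      let ?K = "\<lambda>x. \<phi> (mul (\<iota> x) p)"
      let ?G = "\<lambda>z. f (mul (inv_into U \<phi> (fst z)) (\<iota> (snd z)))"
      have "smooth_at ?K \<epsilon>"
        using smooth_right_mul[of p e] U V unfolding smooth_map_near_def \<iota>_def \<epsilon>_def by simp
      then have "smooth_at (\<lambda>z. ?K (fst z)) (\<epsilon>, \<epsilon>)"
        using smooth_at_compose[OF smooth_at_bounded_linear[OF bounded_linear_fst], of ?K "(\<epsilon>, \<epsilon>)"] by simp
      then have g: "smooth_at (\<lambda>z. (?K (fst z), snd z)) (\<epsilon>, \<epsilon>)"
        by (rule smooth_at_Pair) (intro smooth_at_bounded_linear bounded_linear_snd)
      have "smooth_at ?G (?K \<epsilon>, \<epsilon>)"
        using fun_mul_smooth_at[OF U V, of f] f chart(5)[OF V] by (simp add: \<iota>_def \<epsilon>_def)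
      then have c: "smooth_at (\<lambda>z. ?G (?K (fst z), snd z)) (\<epsilon>, \<epsilon>)"
        by (intro smooth_at_compose[OF g]) simp
      have "\<forall>\<^sub>F h in nhds e. mul h p \<in> U"
        by (rule smooth_map_near_eventually[OF smooth_right_mul]) (use eventually_in_chart[OF U] in simp)
      then have "\<forall>\<^sub>F x in nhds \<epsilon>. mul (\<iota> x) p \<in> U"
        unfolding \<iota>_def \<epsilon>_def by (rule eventually_chart[OF V])
      moreover have "filterlim fst (nhds \<epsilon>) (nhds (\<epsilon>, \<epsilon>))"
        using tendsto_fst[OF filterlim_ident[of "nhds (\<epsilon>, \<epsilon>)"]] by simp
      ultimately have "\<forall>\<^sub>F z in nhds (\<epsilon>, \<epsilon>). mul (\<iota> (fst z)) p \<in> U"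
        unfolding filterlim_iff by blast
      then have "\<forall>\<^sub>F z in nhds (\<epsilon>, \<epsilon>). ?G (?K (fst z), snd z) = H z"
        by eventually_elim (simp add: H_def chart(5)[OF U(1)])
      then show ?thesis using c by (rule smooth_at_cong)
    qed
    have "\<forall>\<^sub>F h in nhds e. smooth_fun_near A (mul p h) f"
      by (rule smooth_map_near_eventually[OF smooth_left_mul]) (use smooth_fun_near_eventually[OF f] in simp)
    then have fl: "\<forall>\<^sub>F y in nhds \<epsilon>. smooth_fun_near A (mul p (\<iota> y)) f"
      unfolding \<iota>_def \<epsilon>_def by (rule eventually_chart[OF V])
    have "\<forall>\<^sub>F h in nhds e. smooth_fun_near A (mul h p) f"
      by (rule smooth_map_near_eventually[OF smooth_right_mul]) (use smooth_fun_near_eventually[OF f] in simp)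
    then have fr: "\<forall>\<^sub>F y in nhds \<epsilon>. smooth_fun_near A (mul (\<iota> y) p) f"
      unfolding \<iota>_def \<epsilon>_def by (rule eventually_chart[OF V])
    have "\<forall>\<^sub>F y in nhds \<epsilon>. smooth_at H (\<epsilon>, y)"
      using tendsto_Pair_const(2)[of \<epsilon> \<epsilon>] smooth_at_eventually[OF H] unfolding filterlim_iff by blast
    then have evl: "\<forall>\<^sub>F y in nhds \<epsilon>. right_field u (mul p (\<iota> y)) f = frechet_derivative H (at (\<epsilon>, y)) (w', 0)"
      using fl
    proof eventually_elim
      case (elim y)
      show ?case
        using smooth_at_slice_fst(2)[OF elim(1), of w'] right_field_apply[OF V elim(2), of w']
        by (simp add: w' H_def assoc flip: \<iota>_def \<epsilon>_def)
    qed
    have "\<forall>\<^sub>F x in nhds \<epsilon>. smooth_at H (x, \<epsilon>)"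
      using tendsto_Pair_const(1)[of \<epsilon> \<epsilon>] smooth_at_eventually[OF H] unfolding filterlim_iff by blast
    then have evr: "\<forall>\<^sub>F x in nhds \<epsilon>. left_field v (mul (\<iota> x) p) f = frechet_derivative H (at (x, \<epsilon>)) (0, w)"
      using fr
    proof eventually_elim
      case (elim x)
      show ?case
        using smooth_at_slice_snd(2)[OF elim(1), of w] left_field_apply[OF V elim(2), of w]
        by (simp add: w H_def flip: \<iota>_def \<epsilon>_def)
    qed
    have "left_field v p (\<lambda>q. right_field u q f) =
        frechet_derivative (\<lambda>y. right_field u (mul p (\<iota> y)) f) (at \<epsilon>) w"
      using left_field_apply[OF V vector_field_smooth[OF vector_field_right_field[OF u] f]]
      by (simp add: w \<iota>_def \<epsilon>_def)
    also have "\<dots> = frechet_derivative (\<lambda>y. frechet_derivative H (at (\<epsilon>, y)) (w', 0)) (at \<epsilon>) w"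
      using frechet_derivative_cong_eventually[OF evl] by simp
    also have "\<dots> = frechet_derivative (\<lambda>z. frechet_derivative H (at z) (w', 0)) (at (\<epsilon>, \<epsilon>)) (0, w)"
      using smooth_at_slice_snd(2)[OF smooth_at_frechet_derivative[OF H]] .
    also have "\<dots> = frechet_derivative (\<lambda>z. frechet_derivative H (at z) (0, w)) (at (\<epsilon>, \<epsilon>)) (w', 0)"
      using H by (rule frechet_derivative_commute)
    also have "\<dots> = frechet_derivative (\<lambda>x. frechet_derivative H (at (x, \<epsilon>)) (0, w)) (at \<epsilon>) w'"
      using smooth_at_slice_fst(2)[OF smooth_at_frechet_derivative[OF H]] by simp
    also have "\<dots> = frechet_derivative (\<lambda>x. left_field v (mul (\<iota> x) p) f) (at \<epsilon>) w'"
      using frechet_derivative_cong_eventually[OF evr] by simp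
    also have "\<dots> = right_field u p (\<lambda>q. left_field v q f)"
      using right_field_apply[OF V vector_field_smooth[OF vector_field_left_field[OF v] f]]
      by (simp add: w' \<iota>_def \<epsilon>_def)
    finally show ?thesis .
  qed
  then show ?thesis by (simp add: lie_bracket_def fun_eq_iff)
qed

end

section \<open>Solvable ideals and traces\<close>

locale real_lie_algebra =
  fixes L :: "'v::real_vector set" and br :: "'v \<Rightarrow> 'v \<Rightarrow> 'v"
  assumes subspace: "subspace L"
    and closed: "x \<in> L \<Longrightarrow> y \<in> L \<Longrightarrow> br x y \<in> L"
    and skew: "br x y = - br y x"
    and add_right: "x \<in> L \<Longrightarrow> y \<in> L \<Longrightarrow> z \<in> L \<Longrightarrow> br x (y + z) = br x y + br x z"
    and scaleR_right: "x \<in> L \<Longrightarrow> y \<in> L \<Longrightarrow> br x (r *\<^sub>R y) = r *\<^sub>R br x y"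
    and jacobi_identity: "x \<in> L \<Longrightarrow> y \<in> L \<Longrightarrow> z \<in> L \<Longrightarrow> br x (br y z) = br (br x y) z + br y (br x z)"
begin

text \<open>By the Jacobi identity \<open>br z\<close> is a derivation, so it maps a bracket of
  elements of \<open>I\<close> to a sum of such brackets.\<close>

lemma lie_ideal_derived_algebra:
  assumes I: "lie_ideal L br I"
  shows "lie_ideal L br (derived_algebra br I)"
proof -
  have sub: "subspace I" and IL: "I \<subseteq> L" and ideal: "\<And>x y. x \<in> L \<Longrightarrow> y \<in> I \<Longrightarrow> br x y \<in> I"
    using I unfolding lie_ideal_def by blast+
  have gen: "br x y \<in> derived_algebra br I" if "x \<in> I" "y \<in> I" for x y
    unfolding derived_algebra_def by (rule span_base) (use that in blast)
  have der: "subspace (derived_algebra br I)"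
    unfolding derived_algebra_def by (rule subspace_span)
  \<comment> \<open>Membership in \<open>I\<close> is carried through the induction, because
    \<open>br z\<close> is known to be linear only on \<open>L\<close> and the partial sums must
    stay there.\<close>
  have "v \<in> I \<and> br z v \<in> derived_algebra br I"
    if z: "z \<in> L" and v: "v \<in> derived_algebra br I" for z v
    using v unfolding derived_algebra_def[of br I]
  proof (induction v rule: span_induct_alt)
    case base
    have "br z (0 *\<^sub>R 0) = 0 *\<^sub>R br z 0"
      using z subspace_0[OF subspace] by (rule scaleR_right)
    then show ?case using subspace_0[OF sub] span_zero by simp
  next
    case (step r u v)
    then obtain x y where u: "u = br x y" and x: "x \<in> I" and y: "y \<in> I" by blast
    have uI: "u \<in> I" using x y IL ideal u by blast
    have "br z u = br (br z x) y + br x (br z y)"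
      unfolding u using z x y IL by (intro jacobi_identity) auto
    then have zu: "br z u \<in> derived_algebra br I"
      using gen[OF ideal[OF z x] y] gen[OF x ideal[OF z y]] subspace_add[OF der] by simp
    have ruI: "r *\<^sub>R u \<in> I" using uI sub by (simp add: subspace_scale)
    have "br z (r *\<^sub>R u + v) = r *\<^sub>R br z u + br z v"
      using z uI ruI step.IH IL by (auto simp: add_right scaleR_right subset_iff)
    then have "br z (r *\<^sub>R u + v) \<in> derived_algebra br I"
      using zu step.IH subspace_add[OF der] subspace_scale[OF der]
      by (simp flip: derived_algebra_def)
    then show ?case
      using ruI step.IH subspace_add[OF sub] by (simp flip: derived_algebra_def)
  qed
  then show ?thesis
    using der IL subspace_0[OF subspace] unfolding lie_ideal_def by blast
qed

text \<open>The last non-zero term of the derived series is abelian, and every term of the series is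
  an ideal of \<open>L\<close>.\<close>

lemma abelian_ideal_of_solvable:
  assumes "lie_ideal L br I" "I \<noteq> {0}" "(derived_algebra br ^^ n) I = {0}"
  shows "\<exists>K. lie_ideal L br K \<and> K \<noteq> {0} \<and> (\<forall>x\<in>K. \<forall>y\<in>K. br x y = 0)"
  using assms
proof (induction n arbitrary: I)
  case (Suc n)
  show ?case
  proof (cases "derived_algebra br I = {0}")
    case True
    then have "br x y = 0" if "x \<in> I" "y \<in> I" for x y
      using that span_base[of "br x y" "{br x y |x y. x \<in> I \<and> y \<in> I}"]
      unfolding derived_algebra_def by blast
    then show ?thesis using Suc.prems by blast
  next
    case False
    then show ?thesis
      using Suc.IH[OF lie_ideal_derived_algebra[OF Suc.prems(1)]] Suc.prems(3)
      by (simp add: funpow_swap1)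
  qed
qed simp

lemma semisimple_if_no_abelian_ideal:
  assumes "\<And>K. lie_ideal L br K \<Longrightarrow> (\<And>x y. x \<in> K \<Longrightarrow> y \<in> K \<Longrightarrow> br x y = 0) \<Longrightarrow> K = {0}"
  shows "semisimple_algebra L br"
  unfolding semisimple_algebra_def solvable_algebra_def
  using abelian_ideal_of_solvable assms by metis

end

lemma linear_between_sum:
  assumes T: "linear_between V W T" and V: "subspace V" and B: "finite B" "B \<subseteq> V"
  shows "T (\<Sum>b\<in>B. r b *\<^sub>R b) = (\<Sum>b\<in>B. r b *\<^sub>R T b)"
  using B
proof (induction B rule: finite_induct)
  case empty
  have "T (0 *\<^sub>R 0) = 0 *\<^sub>R T 0"
    using T subspace_0[OF V] unfolding linear_between_def by blast
  then show ?case by simp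
next
  case (insert b B)
  have "r b *\<^sub>R b \<in> V" "(\<Sum>b\<in>B. r b *\<^sub>R b) \<in> V"
    using insert.prems V by (auto intro!: subspace_scale subspace_sum)
  then show ?case
    using insert T unfolding linear_between_def by simp
qed

text \<open>\<open>T\<^sup>2 = 0\<close>, so the trace vanishes; comparing with a basis \<open>C\<close> of \<open>W\<close> avoids
  proving that the trace does not depend on the basis.\<close>

lemma trace_on_eq_0:
  assumes V: "subspace V" and W: "subspace W" "W \<subseteq> V"
    and T: "linear_between V W T" and TW: "\<And>w. w \<in> W \<Longrightarrow> T w = 0"
  shows "trace_on V T = 0"
proof -
  define B where "B = (SOME B. independent B \<and> span B = V)"
  have "\<exists>B. independent B \<and> span B = V"
    using maximal_independent_subset[of V] span_subspace[OF _ _ V] by metis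
  then have B: "independent B" "span B = V"
    unfolding B_def by (metis (mono_tags, lifting) someI_ex)+
  have "(\<Sum>b\<in>B. representation B (T b) b) = 0"
  \<comment> \<open>Over an infinite \<open>B\<close> the sum is zero by convention, which is all
    that the closing \<open>simp\<close> uses.\<close>
  proof (cases "finite B")
    case True
    obtain C where C: "C \<subseteq> W" "independent C" "W \<subseteq> span C"
      using maximal_independent_subset[of W] by metis
    then have fin: "finite C"
      using independent_span_bound[OF True C(2)] B(2) W(2) by blast
    have TC: "T v \<in> span C" if "v \<in> V" for v
      using T C(3) that unfolding linear_between_def by blast
    have BV: "B \<subseteq> V" using B(2) span_superset by blast
    have "representation B (T b) b = (\<Sum>c\<in>C. representation C (T b) c * representation B c b)"
      if b: "b \<in> B" for b
    proof -
      have "T b = (\<Sum>c\<in>C. representation C (T b) c *\<^sub>R c)"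
        using sum_representation_eq[OF C(2) TC fin] b BV by auto
      then have "representation B (T b) b =
          representation B (\<Sum>c\<in>C. representation C (T b) c *\<^sub>R c) b" by simp
      also have "\<dots> = (\<Sum>c\<in>C. representation B (representation C (T b) c *\<^sub>R c) b)"
        using B C(1) W(2) by (subst representation_sum) (auto intro: span_scale)
      also have "\<dots> = (\<Sum>c\<in>C. representation C (T b) c * representation B c b)"
        using B C(1) W(2) by (intro sum.cong refl) (subst representation_scale, auto)
      finally show ?thesis .
    qed
    then have "(\<Sum>b\<in>B. representation B (T b) b) =
        (\<Sum>b\<in>B. \<Sum>c\<in>C. representation C (T b) c * representation B c b)" by simp
    also have "\<dots> = (\<Sum>c\<in>C. \<Sum>b\<in>B. representation C (T b) c * representation B c b)"
      by (rule sum.swap)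
    also have "\<dots> = 0"
    \<comment> \<open>For fixed \<open>c\<close> the inner sum is the \<open>c\<close>-coefficient
      of \<open>T c\<close>, with \<open>c\<close> expanded in \<open>B\<close>; and
      \<open>T c\<close> is zero since \<open>c\<close> lies in \<open>W\<close>.\<close>
    proof (rule sum.neutral, rule ballI)
      fix c assume c: "c \<in> C"
      have "c = (\<Sum>b\<in>B. representation B c b *\<^sub>R b)"
        using sum_representation_eq[OF B(1) _ True] c C(1) W(2) B(2) by auto
      then have "T c = (\<Sum>b\<in>B. representation B c b *\<^sub>R T b)"
        using linear_between_sum[OF T V True BV] by metis
      then have "(\<Sum>b\<in>B. representation B c b *\<^sub>R T b) = 0"
        using TW c C(1) by auto
      then have "representation C (\<Sum>b\<in>B. representation B c b *\<^sub>R T b) c = 0"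
        by (simp add: representation_zero)
      moreover have "representation C (\<Sum>b\<in>B. representation B c b *\<^sub>R T b) c =
          (\<Sum>b\<in>B. representation C (representation B c b *\<^sub>R T b) c)"
        using C(2) TC BV by (subst representation_sum) (auto intro: span_scale)
      moreover have "\<dots> = (\<Sum>b\<in>B. representation C (T b) c * representation B c b)"
        using C(2) TC BV by (intro sum.cong refl) (subst representation_scale, auto)
      ultimately show "(\<Sum>b\<in>B. representation C (T b) c * representation B c b) = 0" by simp
    qed
    finally show ?thesis .
  qed simp
  then show ?thesis unfolding trace_on_def B_def[symmetric] by simp
qed


section \<open>Bi-invariant metrics\<close>

text \<open>The connection is a parameter because the Einstein condition and the parallelism of
  \<open>J\<close> each bring a Levi-Civita connection of their own; the locale is used once for
  each.\<close>

locale bi_invariant_lie_group = lie_group mul e inve A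
  for mul :: "'g::{t2_space, second_countable_topology} \<Rightarrow> 'g \<Rightarrow> 'g"
    and e :: 'g and inve :: "'g \<Rightarrow> 'g" and A :: "('g, 'e::euclidean_space) chart set" +
  fixes g :: "'g metric" and D :: "'g connection"
  assumes metric: "pseudo_riemannian A g"
    and bi_invariant: "bi_invariant_metric mul A g"
    and levi_civita: "levi_civita A g D"
begin

lemma metric_sym: "u \<in> tangent_space A p \<Longrightarrow> v \<in> tangent_space A p \<Longrightarrow> g p u v = g p v u"
  using metric unfolding pseudo_riemannian_def by blast

lemma metric_add_right:
  "u \<in> tangent_space A p \<Longrightarrow> v \<in> tangent_space A p \<Longrightarrow> w \<in> tangent_space A p \<Longrightarrow>
    g p u (v + w) = g p u v + g p u w"
  using metric unfolding pseudo_riemannian_def linear_between_def by blast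

lemma metric_scaleR_right:
  "u \<in> tangent_space A p \<Longrightarrow> v \<in> tangent_space A p \<Longrightarrow> g p u (r *\<^sub>R v) = r * g p u v"
  using metric unfolding pseudo_riemannian_def linear_between_def real_scaleR_def by blast

lemma metric_nondegenerate:
  "u \<in> tangent_space A p \<Longrightarrow> (\<And>v. v \<in> tangent_space A p \<Longrightarrow> g p u v = 0) \<Longrightarrow> u = 0"
  using metric unfolding pseudo_riemannian_def by blast

lemma metric_smooth:
  "vector_field A X \<Longrightarrow> vector_field A Y \<Longrightarrow> smooth_fun_on A UNIV (\<lambda>p. g p (X p) (Y p))"
  using metric unfolding pseudo_riemannian_def by blast

lemma metric_left_field:
  assumes "u \<in> tangent_space A e" "v \<in> tangent_space A e"
  shows "g q (left_field u q) (left_field v q) = g e u v"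
proof -
  have "isometry A g (\<lambda>p. mul q p)"
    using bi_invariant unfolding bi_invariant_metric_def left_invariant_metric_def by blast
  then have "g (mul q e) (differential A (\<lambda>p. mul q p) e u) (differential A (\<lambda>p. mul q p) e v) = g e u v"
    using assms unfolding isometry_def by blast
  then show ?thesis by (simp add: left_field_def)
qed

lemma metric_right_field:
  assumes "u \<in> tangent_space A e" "v \<in> tangent_space A e"
  shows "g q (right_field u q) (right_field v q) = g e u v"
proof -
  have "isometry A g (\<lambda>p. mul p q)"
    using bi_invariant unfolding bi_invariant_metric_def right_invariant_metric_def by blast
  then have "g (mul e q) (differential A (\<lambda>p. mul p q) e u) (differential A (\<lambda>p. mul p q) e v) = g e u v"
    using assms unfolding isometry_def by blast
  then show ?thesis by (simp add: right_field_def)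
qed

lemma linear_left_field: "linear left_field"
  by (rule linearI) (simp_all add: left_field_add left_field_scaleR)

lemma sum_field_apply: "(\<Sum>i\<in>I. X i) p = (\<Sum>i\<in>I. X i p)" for X :: "'i \<Rightarrow> 'g vfield"
  by (induction I rule: infinite_finite_induct) auto

text \<open>The coefficients of a vector field in a left invariant frame are its products with the
  dual frame, so they are smooth.\<close>

lemma left_invariant_frame:
  "\<exists>F E. (\<forall>b :: 'e. vector_field A (F b) \<and> vector_field A (E b)) \<and>
    (\<forall>X. vector_field A X \<longrightarrow> X = (\<Sum>b\<in>Basis. mult_field (\<lambda>q. g q (X q) (E b q)) (F b)))"
proof -
  obtain U \<phi> where U: "(U, \<phi>) \<in> A" "e \<in> U" by (rule chart_at)
  define T where "T = chart_vec A U \<phi> e"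
  have T: "linear T" unfolding T_def by (rule linear_chart_vec[OF U])
  have TT: "T w \<in> tangent_space A e" for w unfolding T_def tangent_space_eq[OF U] by blast
  \<comment> \<open>\<open>M\<close> is the Gram operator of the metric at the identity.
    Non-degeneracy makes it injective, hence surjective, and the vectors \<open>T (inv M b)\<close>
    form the basis dual to the vectors \<open>T b\<close>, whatever the signature.\<close>
  define M where "M w = (\<Sum>b\<in>Basis. g e (T w) (T b) *\<^sub>R b)" for w
  have sym: "g e (T w) (T w') = g e (T w') (T w)" for w w' by (rule metric_sym[OF TT TT])
  have lin2: "linear (\<lambda>w'. g e (T w) (T w'))" for w
    by (rule linearI)
      (simp_all add: linear_add[OF T] linear_scale[OF T] metric_add_right metric_scaleR_right TT)
  have "linear M"
    unfolding M_def sym[of _ "_ :: 'e"]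
  proof (intro linear_compose_sum ballI)
    fix b :: 'e
    show "linear (\<lambda>w. g e (T w) (T b) *\<^sub>R b)"
      by (rule linearI)
        (simp_all add: sym[of _ b] linear_add[OF lin2] linear_scale[OF lin2] scaleR_add_left)
  qed
  have M: "M w \<bullet> w' = g e (T w) (T w')" for w w'
  proof -
    have "g e (T w) (T w') = g e (T w) (T (\<Sum>b\<in>Basis. (w' \<bullet> b) *\<^sub>R b))"
      by (simp only: euclidean_representation)
    also have "\<dots> = (\<Sum>b\<in>Basis. (w' \<bullet> b) * g e (T w) (T b))"
      by (simp add: linear_sum[OF lin2] linear_scale[OF lin2])
    finally show ?thesis
      by (simp add: M_def inner_sum_left inner_commute[of w'] mult.commute)
  qed
  have "inj M"
  proof (rule linear_injective_0[OF \<open>linear M\<close>, THEN iffD2], intro allI impI)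
    fix w assume "M w = 0"
    then have "g e (T w) (T w') = 0" for w' using M[of w w'] by simp
    then have "T w = 0"
      using TT by (intro metric_nondegenerate[of _ e]) (auto simp: tangent_space_eq[OF U] T_def)
    then show "w = 0" unfolding T_def by (rule chart_vec_eq_0D[OF U])
  qed
  then have "surj M" using \<open>linear M\<close> by (simp add: linear_injective_imp_surjective)
  define F where "F b = left_field (T b)" for b
  define E where "E b = left_field (T (inv M b))" for b
  show ?thesis
  proof (rule exI[of _ F], rule exI[of _ E], intro conjI allI impI)
    fix b
    show "vector_field A (F b)" "vector_field A (E b)"
      unfolding F_def E_def by (intro vector_field_left_field TT)+
  next
    fix X assume X: "vector_field A X"
    show "X = (\<Sum>b\<in>Basis. mult_field (\<lambda>q. g q (X q) (E b q)) (F b))"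
    proof
      fix q
      obtain w where w: "left_field (T w) q = X q"
        using tangent_eq_left_field[OF vector_field_tangent[OF X], of q]
        unfolding tangent_space_eq[OF U] T_def by blast
      \<comment> \<open>Left invariance moves the product to the identity, so that duality there
        gives duality at every point.\<close>
      have c: "g q (X q) (E b q) = w \<bullet> b" for b
      proof -
        have "g q (X q) (E b q) = g e (T (inv M b)) (T w)"
          unfolding w[symmetric] E_def metric_left_field[OF TT TT] by (rule sym)
        then show ?thesis
          using surj_f_inv_f[OF \<open>surj M\<close>] by (simp add: inner_commute flip: M)
      qed
      have "X q = left_field (T (\<Sum>b\<in>Basis. (w \<bullet> b) *\<^sub>R b)) q"
        by (simp only: euclidean_representation w)
      also have "\<dots> = (\<Sum>b\<in>Basis. (w \<bullet> b) *\<^sub>R left_field (T b)) q"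
        by (simp only: linear_sum[OF T] linear_scale[OF T] linear_sum[OF linear_left_field]
            linear_scale[OF linear_left_field])
      also have "\<dots> = (\<Sum>b\<in>Basis. (w \<bullet> b) *\<^sub>R F b q)"
        by (simp add: sum_field_apply F_def scaleR_fun_def)
      finally show "X q = (\<Sum>b\<in>Basis. mult_field (\<lambda>q. g q (X q) (E b q)) (F b)) q"
        unfolding sum_field_apply mult_field_def c .
    qed
  qed
qed

text \<open>Expanding the field in the global frame and using linearity over smooth functions leaves
  an expression in which the field occurs only through its coefficients at \<open>p\<close>.\<close>

lemma tensorial:
  assumes add: "\<And>X Y. vector_field A X \<Longrightarrow> vector_field A Y \<Longrightarrow> Q (X + Y) = Q X + (Q Y :: 'g vfield)"
    and mult: "\<And>h X. smooth_fun_on A UNIV h \<Longrightarrow> vector_field A X \<Longrightarrow> Q (mult_field h X) = mult_field h (Q X)"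
    and X: "vector_field A X" and Y: "vector_field A Y" and eq: "X p = Y p"
  shows "Q X p = Q Y p"
proof -
  obtain F E where FE: "\<And>b :: 'e. vector_field A (F b)" "\<And>b. vector_field A (E b)"
    and frame: "\<And>X. vector_field A X \<Longrightarrow> X = (\<Sum>b\<in>Basis. mult_field (\<lambda>q. g q (X q) (E b q)) (F b))"
    using left_invariant_frame by blast
  have "Q (mult_field (\<lambda>p. 0) 0) = mult_field (\<lambda>p. 0) (Q 0)"
    using smooth_fun_near_const by (intro mult vector_field_zero) (simp add: smooth_fun_on_iff)
  then have Q0: "Q 0 = 0" by (simp add: mult_field_const)
  have Qsum: "Q (\<Sum>i\<in>I. Z i) = (\<Sum>i\<in>I. Q (Z i))"
    if "\<And>i. vector_field A (Z i)" for Z and I :: "'e set"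
  proof (induction I rule: infinite_finite_induct)
    case (insert i I)
    have "vector_field A (sum Z I)" by (intro vector_field_sum that)
    then show ?case
      unfolding sum.insert[OF insert.hyps] insert.IH[symmetric] by (rule add[OF that])
  next
    case (infinite I)
    show ?case unfolding sum.infinite[OF infinite] by (rule Q0)
  next
    case empty
    show ?case unfolding sum.empty by (rule Q0)
  qed
  have "Q Z p = (\<Sum>b\<in>Basis. g p (Z p) (E b p) *\<^sub>R Q (F b) p)" if Z: "vector_field A Z" for Z
  proof -
    have "Q Z = Q (\<Sum>b\<in>Basis. mult_field (\<lambda>q. g q (Z q) (E b q)) (F b))"
      by (rule arg_cong[OF frame[OF Z]])
    also have "\<dots> = (\<Sum>b\<in>Basis. mult_field (\<lambda>q. g q (Z q) (E b q)) (Q (F b)))"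
      by (simp add: Qsum mult FE Z vector_field_mult metric_smooth)
    finally show ?thesis by (simp add: sum_field_apply mult_field_def)
  qed
  with X Y eq show ?thesis by simp
qed

section \<open>The Levi-Civita connection on invariant fields\<close>

lemma
  assumes "vector_field A X" "vector_field A Y"
  shows vector_field_connection: "vector_field A (D X Y)"
    and torsion_free: "D X Y - D Y X = lie_bracket A X Y"
    and connection_add_left: "vector_field A Z \<Longrightarrow> D (X + Y) Z = D X Z + D Y Z"
    and connection_add_right: "vector_field A Z \<Longrightarrow> D X (Y + Z) = D X Y + D X Z"
    and connection_mult_left: "smooth_fun_on A UNIV h \<Longrightarrow> D (mult_field h X) Y = mult_field h (D X Y)"
    and connection_mult_right: "smooth_fun_on A UNIV h \<Longrightarrow>
      D X (mult_field h Y) = mult_field (\<lambda>p. X p h) Y + mult_field h (D X Y)"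
    and metric_compatible: "vector_field A Z \<Longrightarrow>
      X p (\<lambda>q. g q (Y q) (Z q)) = g p (D X Y p) (Z p) + g p (Y p) (D X Z p)"
  using assms levi_civita unfolding levi_civita_def affine_connection_def by blast+

text \<open>A torsion-free connection presents the bracket as a difference of covariant derivatives,
  which are smooth fields.\<close>

lemma vector_field_lie_bracket:
  "vector_field A X \<Longrightarrow> vector_field A Y \<Longrightarrow> vector_field A (lie_bracket A X Y)"
  using torsion_free[of X Y] vector_field_diff[of "D X Y" "D Y X"] vector_field_connection by metis

lemma connection_tensorial:
  assumes "vector_field A X" "vector_field A Y" "vector_field A Z" "X p = Y p"
  shows "D X Z p = D Y Z p"
  using assms
  by (intro tensorial[where Q = "\<lambda>X. D X Z"]) (simp_all add: connection_add_left connection_mult_left)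

lemma connection_left_skew:
  assumes X: "vector_field A X" and Y: "Y \<in> lie_algebra mul A" and Z: "Z \<in> lie_algebra mul A"
  shows "g p (D X Y p) (Z p) = - g p (D X Z p) (Y p)"
proof -
  note vf = lie_algebra_vector_field[OF Y] lie_algebra_vector_field[OF Z]
  have "g q (Y q) (Z q) = g e (Y e) (Z e)" for q
    using metric_left_field[OF vector_field_tangent[OF vf(1)] vector_field_tangent[OF vf(2)], of q]
    unfolding lie_algebra_eq_left_field[OF Y, symmetric] lie_algebra_eq_left_field[OF Z, symmetric] .
  then have "(\<lambda>q. g q (Y q) (Z q)) = (\<lambda>q. g e (Y e) (Z e))" by (rule ext)
  then have "X p (\<lambda>q. g q (Y q) (Z q)) = 0"
    by (simp only: tangent_const[OF vector_field_tangent[OF X]])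
  then have "g p (D X Y p) (Z p) = - g p (Y p) (D X Z p)"
    using metric_compatible[OF X vf, of p] by simp
  then show ?thesis
    using metric_sym[OF vector_field_tangent[OF vf(1)] vector_field_tangent[OF vector_field_connection[OF X vf(2)]]]
    by simp
qed

text \<open>Left invariant fields commute with right invariant ones, whose mutual products are
  constant: this is the Killing equation for \<open>X\<close>.\<close>

lemma connection_killing:
  assumes X: "X \<in> lie_algebra mul A" and Y: "vector_field A Y" and Z: "vector_field A Z"
  shows "g p (D Y X p) (Z p) = - g p (D Z X p) (Y p)"
proof -
  note vf = lie_algebra_vector_field[OF X]
  obtain v where v: "v \<in> tangent_space A e" "right_field v p = Y p"
    using tangent_eq_right_field[OF vector_field_tangent[OF Y]] by blast
  obtain w where w: "w \<in> tangent_space A e" "right_field w p = Z p"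
    using tangent_eq_right_field[OF vector_field_tangent[OF Z]] by blast
  \<comment> \<open>Commuting fields satisfy \<open>D X R = D R X\<close>, and the right-hand side
    at \<open>p\<close> depends on \<open>R\<close> only through its value there. So the right
    invariant field can be exchanged for \<open>V\<close>.\<close>
  have D: "D X (right_field u) p = D V X p"
    if u: "u \<in> tangent_space A e" "right_field u p = V p" and V: "vector_field A V" for u V
  proof -
    note R = vector_field_right_field[OF u(1)]
    have "lie_bracket A X (right_field u) = 0"
      using left_right_commute[OF vector_field_tangent[OF vf] u(1)]
      unfolding lie_algebra_eq_left_field[OF X, symmetric] .
    then have "D X (right_field u) = D (right_field u) X"
      using torsion_free[OF vf R] by simp
    then show ?thesis using connection_tensorial[OF R V vf u(2)] by simp
  qed
  have "X p (\<lambda>q. g q (right_field v q) (right_field w q)) = 0"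
    unfolding metric_right_field[OF v(1) w(1)] by (rule tangent_const[OF vector_field_tangent[OF vf]])
  then have "g p (D Y X p) (Z p) + g p (Y p) (D Z X p) = 0"
    using metric_compatible[OF vf vector_field_right_field[OF v(1)] vector_field_right_field[OF w(1)], of p]
    by (simp add: D[OF v Y] D[OF w Z] v(2) w(2))
  then show ?thesis
    using metric_sym[OF vector_field_tangent[OF Y] vector_field_tangent[OF vector_field_connection[OF Z vf]]]
    by simp
qed

text \<open>Three sign changes, alternately from constant products and from the Killing equation,
  exchange \<open>X\<close> and \<open>Y\<close> in \<open>g p (D X Y p) (Z p)\<close>. The
  symmetric part of \<open>D\<close> is thus orthogonal to all left invariant \<open>Z\<close>,
  which fill the tangent space, and torsion determines the rest.\<close>

lemma connection_eq_half_bracket: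
  assumes X: "X \<in> lie_algebra mul A" and Y: "Y \<in> lie_algebra mul A"
  shows "D X Y = (1/2) *\<^sub>R lie_bracket A X Y"
proof -
  note vfX = lie_algebra_vector_field[OF X] and vfY = lie_algebra_vector_field[OF Y]
  have "(D X Y + D Y X) p = 0" for p
  proof (rule metric_nondegenerate)
    show S: "(D X Y + D Y X) p \<in> tangent_space A p"
      by (intro vector_field_tangent vector_field_add vector_field_connection vfX vfY)
    fix u assume u: "u \<in> tangent_space A p"
    then obtain v where v: "v \<in> tangent_space A e" "left_field v p = u"
      by (rule tangent_eq_left_field)
    define Z where "Z = left_field v"
    have Z: "Z \<in> lie_algebra mul A" unfolding Z_def by (rule left_field_in_lie_algebra[OF v(1)])
    note vfZ = lie_algebra_vector_field[OF Z]
    have "g p (D X Y p) (Z p) = - g p (D X Z p) (Y p)"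
      by (rule connection_left_skew[OF vfX Y Z])
    also have "g p (D X Z p) (Y p) = - g p (D Y Z p) (X p)"
      by (rule connection_killing[OF Z vfX vfY])
    also have "g p (D Y Z p) (X p) = - g p (D Y X p) (Z p)"
      by (rule connection_left_skew[OF vfY Z X])
    finally have "g p (D X Y p) u + g p (D Y X p) u = 0" using v(2) by (simp add: Z_def)
    moreover have "D X Y p \<in> tangent_space A p" "D Y X p \<in> tangent_space A p"
      by (intro vector_field_tangent vector_field_connection vfX vfY)+
    ultimately show "g p ((D X Y + D Y X) p) u = 0"
      using metric_sym[OF S u] metric_sym[OF _ u] metric_add_right[OF u] by simp
  qed
  then have "D Y X = - D X Y" by (simp add: fun_eq_iff eq_neg_iff_add_eq_0 add.commute)
  then have "lie_bracket A X Y = 2 *\<^sub>R D X Y"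
    using torsion_free[OF vfX vfY] by (simp add: scaleR_2)
  then show ?thesis by simp
qed

sublocale lie: real_lie_algebra "lie_algebra mul A" "lie_bracket A"
proof
  have "0 \<in> lie_algebra mul A"
    unfolding lie_algebra_def by (auto simp: vector_field_zero differential_def fun_eq_iff)
  moreover have "X + Y \<in> lie_algebra mul A" if "X \<in> lie_algebra mul A" "Y \<in> lie_algebra mul A" for X Y
    using that unfolding lie_algebra_def by (auto simp: vector_field_add differential_def fun_eq_iff)
  moreover have "r *\<^sub>R X \<in> lie_algebra mul A" if "X \<in> lie_algebra mul A" for r X
    using that vector_field_scaleR[of X r] unfolding lie_algebra_def
    by (auto simp: differential_def fun_eq_iff) (simp_all add: scaleR_fun_def)
  ultimately show "subspace (lie_algebra mul A)" unfolding subspace_def by blast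
next
  fix X Y Z :: "'g vfield" and r :: real
  show skew: "lie_bracket A X Y = - lie_bracket A Y X" for X Y :: "'g vfield"
    by (rule lie_bracket_commute)
  assume X: "X \<in> lie_algebra mul A" and Y: "Y \<in> lie_algebra mul A"
  note vf = lie_algebra_vector_field
  show "lie_bracket A X Y \<in> lie_algebra mul A"
    using X Y by (intro lie_bracket_in_lie_algebra vector_field_lie_bracket vf)
  \<comment> \<open>Homogeneity is the Leibniz rule for a constant function; the correction term
    disappears because tangent vectors kill constants.\<close>
  have "lie_bracket A (mult_field (\<lambda>p. r) Y) X =
      mult_field (\<lambda>p. r) (lie_bracket A Y X) - mult_field (\<lambda>p. X p (\<lambda>q. r)) Y"
    using X Y by (intro lie_bracket_mult vf) (simp_all add: smooth_fun_on_iff smooth_fun_near_const)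
  then show "lie_bracket A X (r *\<^sub>R Y) = r *\<^sub>R lie_bracket A X Y"
    unfolding tangent_const[OF vector_field_tangent[OF vf[OF X]]] mult_field_const
    using skew[of X] by (simp add: skew[of X "r *\<^sub>R Y"])
  assume Z: "Z \<in> lie_algebra mul A"
  show "lie_bracket A X (Y + Z) = lie_bracket A X Y + lie_bracket A X Z"
    using lie_bracket_add[OF vf[OF Y] vf[OF Z] vf[OF X]] skew[of X "Y + Z"] skew[of X Y] skew[of X Z] by simp
  show "lie_bracket A X (lie_bracket A Y Z) =
      lie_bracket A (lie_bracket A X Y) Z + lie_bracket A Y (lie_bracket A X Z)"
    using X Y Z by (intro jacobi vf)
qed


section \<open>Curvature and parallel complex structures\<close>

lemma connection_diff_left:
  assumes "vector_field A X" "vector_field A Y" "vector_field A Z"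
  shows "D (X - Y) Z = D X Z - D Y Z"
proof -
  have "D (X - Y + Y) Z = D (X - Y) Z + D Y Z"
    using assms by (intro connection_add_left vector_field_diff)
  then show ?thesis by simp
qed

lemma curvature_add_left:
  assumes "vector_field A X" "vector_field A X'" "vector_field A Y" "vector_field A Z"
  shows "curvature A D (X + X') Y Z = curvature A D X Y Z + curvature A D X' Y Z"
  using assms
  by (simp add: curvature_def connection_add_left connection_add_right vector_field_connection
      lie_bracket_add vector_field_lie_bracket)

text \<open>The derivative of \<open>h\<close> along \<open>Y\<close> appears twice, from
  \<open>D Y (mult_field h (D X Z))\<close> and from the bracket term, with opposite signs.\<close>

lemma curvature_mult_left:
  assumes h: "smooth_fun_on A UNIV h" and X: "vector_field A X" and Y: "vector_field A Y"
    and Z: "vector_field A Z"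
  shows "curvature A D (mult_field h X) Y Z = mult_field h (curvature A D X Y Z)"
proof -
  have Yh: "smooth_fun_on A UNIV (\<lambda>p. Y p h)"
    using h Y by (simp add: smooth_fun_on_iff vector_field_smooth)
  have "D (lie_bracket A (mult_field h X) Y) Z =
      mult_field h (D (lie_bracket A X Y) Z) - mult_field (\<lambda>p. Y p h) (D X Z)"
    using h Yh X Y Z
    by (simp add: lie_bracket_mult connection_diff_left vector_field_mult vector_field_lie_bracket
        connection_mult_left)
  then show ?thesis
    using h X Y Z
    by (simp add: curvature_def connection_mult_left connection_mult_right vector_field_connection)
      (simp add: mult_field_def fun_eq_iff scaleR_fun_def algebra_simps)
qed

lemma curvature_tensorial:
  assumes "vector_field A X" "vector_field A X'" "vector_field A Y" "vector_field A Z" "X p = X' p"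
  shows "curvature A D X Y Z p = curvature A D X' Y Z p"
  using assms
  by (intro tensorial[where Q = "\<lambda>X. curvature A D X Y Z"])
    (simp_all add: curvature_add_left curvature_mult_left)

lemma ricci_abelian_ideal:
  assumes K: "lie_ideal (lie_algebra mul A) (lie_bracket A) K"
    and abelian: "\<And>X Y. X \<in> K \<Longrightarrow> Y \<in> K \<Longrightarrow> lie_bracket A X Y = 0"
    and Y: "Y \<in> lie_algebra mul A" and Z: "Z \<in> K"
  shows "ricci A D Y Z e = 0"
proof -
  let ?L = "lie_algebra mul A"
  let ?T = "\<lambda>u. curvature A D (extend_field A e u) Y Z e"
  have sub: "subspace K" and KL: "\<And>X. X \<in> K \<Longrightarrow> X \<in> ?L"
    and ideal: "\<And>X Y. X \<in> ?L \<Longrightarrow> Y \<in> K \<Longrightarrow> lie_bracket A X Y \<in> K"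
    using K unfolding lie_ideal_def by blast+
  note vf = lie_algebra_vector_field
  have ideal': "lie_bracket A X Y \<in> K" if "X \<in> K" "Y \<in> ?L" for X Y
    using ideal[OF that(2,1)] lie_bracket_commute[of X Y] subspace_neg[OF sub] by simp
  have DK: "D X V \<in> K" if "X \<in> ?L" "V \<in> K" for X V
    using that KL ideal subspace_scale[OF sub] by (simp add: connection_eq_half_bracket)
  have D0: "D X V = 0" if "X \<in> K" "V \<in> K" for X V
    using that KL abelian by (simp add: connection_eq_half_bracket)
  have curvK: "curvature A D X Y Z \<in> K" if "X \<in> ?L" for X
    unfolding curvature_def using that Y Z
    by (intro subspace_diff[OF sub] DK lie.closed)
  \<comment> \<open>Each of the three terms contains the covariant derivative of one field of
    \<open>K\<close> along another.\<close>
  have curv0: "curvature A D X Y Z = 0" if "X \<in> K" for X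
  proof -
    have "D Y (0 :: 'g vfield) = 0"
      using D0[OF subspace_0[OF sub] subspace_0[OF sub]]
        connection_eq_half_bracket[OF Y KL[OF subspace_0[OF sub]]]
        lie.scaleR_right[OF Y KL[OF subspace_0[OF sub]], of 0] by simp
    then show ?thesis
      unfolding curvature_def using that Y Z by (simp add: D0 DK ideal')
  qed
  \<comment> \<open>\<open>extend_field\<close> chooses an unknown extension of \<open>u\<close>.
    Tensoriality replaces it by the left invariant one, on which \<open>D\<close> is half the
    bracket.\<close>
  have T: "?T u = curvature A D (left_field u) Y Z e" if u: "u \<in> tangent_space A e" for u
  proof -
    have "vector_field A (left_field u) \<and> left_field u e = u"
      using u vector_field_left_field left_field_at_e by blast
    then have "vector_field A (extend_field A e u) \<and> extend_field A e u e = u"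
      unfolding extend_field_def by (rule someI[where P = "\<lambda>X. vector_field A X \<and> X e = u"])
    then show ?thesis
      using vf[OF Y] vf[OF KL[OF Z]] u
      by (intro curvature_tensorial) (simp_all add: vector_field_left_field left_field_at_e)
  qed
  have ev: "linear (\<lambda>X :: 'g vfield. X e)" by (rule linearI) (simp_all add: scaleR_fun_def)
  have "trace_on (tangent_space A e) ?T = 0"
  \<comment> \<open>Evaluation at the identity is linear and determines a left invariant field, so
    it transports \<open>K\<close> to the subspace required.\<close>
  proof (rule trace_on_eq_0[where W = "(\<lambda>X. X e) ` K"])
    show "subspace ((\<lambda>X. X e) ` K)" by (rule linear_subspace_image[OF ev sub])
    show "(\<lambda>X. X e) ` K \<subseteq> tangent_space A e" using KL vf vector_field_tangent by blast
    show "?T w = 0" if "w \<in> (\<lambda>X. X e) ` K" for w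
    proof -
      obtain X where X: "X \<in> K" "w = X e" using \<open>w \<in> (\<lambda>X. X e) ` K\<close> by blast
      then show ?thesis
        using T[of w] vector_field_tangent[OF vf[OF KL]] curv0 lie_algebra_eq_left_field[OF KL] by simp
    qed
    show "linear_between (tangent_space A e) ((\<lambda>X. X e) ` K) ?T"
      unfolding linear_between_def
    proof (intro conjI ballI allI)
      fix u assume u: "u \<in> tangent_space A e"
      show "?T u \<in> (\<lambda>X. X e) ` K"
        using T[OF u] curvK[OF left_field_in_lie_algebra[OF u]] by simp
      show "?T (r *\<^sub>R u) = r *\<^sub>R ?T u" for r
      proof -
        have "curvature A D (mult_field (\<lambda>p. r) (left_field u)) Y Z =
            mult_field (\<lambda>p. r) (curvature A D (left_field u) Y Z)"
          using u Y Z KL by (intro curvature_mult_left vf vector_field_left_field)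
            (simp_all add: smooth_fun_on_iff smooth_fun_near_const)
        then show ?thesis
          using u subspace_scale[OF subspace_tangent_space u]
          by (simp add: T left_field_scaleR mult_field_const) (simp add: scaleR_fun_def)
      qed
      fix v assume v: "v \<in> tangent_space A e"
      show "?T (u + v) = ?T u + ?T v"
        using u v subspace_add[OF subspace_tangent_space u v] Y Z KL
        by (simp add: T left_field_add curvature_add_left vector_field_left_field vf)
    qed
  qed (rule subspace_tangent_space)
  then show ?thesis by (simp add: ricci_def)
qed

lemma einstein_imp_semisimple:
  assumes ricci: "\<And>Y Z p. vector_field A Y \<Longrightarrow> vector_field A Z \<Longrightarrow> ricci A D Y Z p = c * g p (Y p) (Z p)"
    and c: "c \<noteq> 0"
  shows "semisimple_lie_group mul A"
  unfolding semisimple_lie_group_def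
proof (rule lie.semisimple_if_no_abelian_ideal)
  fix K assume K: "lie_ideal (lie_algebra mul A) (lie_bracket A) K"
    and abelian: "\<And>X Y. X \<in> K \<Longrightarrow> Y \<in> K \<Longrightarrow> lie_bracket A X Y = 0"
  have KL: "K \<subseteq> lie_algebra mul A" and "0 \<in> K"
    using K subspace_0 unfolding lie_ideal_def by blast+
  have "Z = 0" if Z: "Z \<in> K" for Z
  proof -
    have ZL: "Z \<in> lie_algebra mul A" using Z KL by blast
    note Zt = vector_field_tangent[OF lie_algebra_vector_field[OF ZL]]
    have "Z e = 0"
    proof (rule metric_nondegenerate[OF Zt])
      fix v assume v: "v \<in> tangent_space A e"
      note V = left_field_in_lie_algebra[OF v]
      have "c * g e (left_field v e) (Z e) = 0"
        using ricci_abelian_ideal[OF K abelian V Z] ricci[OF lie_algebra_vector_field[OF V] lie_algebra_vector_field[OF ZL]]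
        by simp
      then show "g e (Z e) v = 0" using c metric_sym[OF Zt v] by (simp add: left_field_at_e[OF v])
    qed
    \<comment> \<open>A left invariant field that vanishes at the identity vanishes
      everywhere.\<close>
    then have "Z = left_field 0" using lie_algebra_eq_left_field[OF ZL] by simp
    then show ?thesis using linear_0[OF linear_left_field] by simp
  qed
  then show "K = {0}" using \<open>0 \<in> K\<close> by blast
qed

text \<open>Parallelism lets \<open>J\<close> pass through the second argument of \<open>D\<close>.
  For all fields this yields integrability through torsion-freeness; for left invariant ones, where
  \<open>D\<close> is half the bracket, it yields complex linearity of the bracket.\<close>

lemma parallel_imp_bi_invariant:
  assumes J: "almost_complex A J" and inv: "left_invariant_endo mul A J" and par: "parallel_endo A D J"
  shows "bi_invariant_complex_structure mul A J"
  unfolding bi_invariant_complex_structure_def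
proof (intro conjI ballI J inv)
  have vfJ: "vector_field A (app_field J X)" if "vector_field A X" for X
    using J that unfolding almost_complex_def by blast
  have J_lin: "J p (u + v) = J p u + J p v" "J p (r *\<^sub>R u) = r *\<^sub>R J p u" "J p (J p u) = - u"
    if "u \<in> tangent_space A p" "v \<in> tangent_space A p" for p u v r
    using J that unfolding almost_complex_def linear_between_def by blast+
  have DJ: "D X (app_field J Y) = app_field J (D X Y)" if "vector_field A X" "vector_field A Y" for X Y
    using par that unfolding parallel_endo_def by simp
  have JJ: "app_field J (app_field J X) = - X" if "vector_field A X" for X
    using J_lin(3)[OF vector_field_tangent[OF that] vector_field_tangent[OF that]]
    by (simp add: app_field_def fun_eq_iff)
  have J_add: "app_field J (X + Y) = app_field J X + app_field J Y" if "vector_field A X" "vector_field A Y" for X Y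
    using J_lin(1)[OF vector_field_tangent[OF that(1)] vector_field_tangent[OF that(2)]]
    by (simp add: app_field_def fun_eq_iff)
  have J_scale: "app_field J (r *\<^sub>R X) = r *\<^sub>R app_field J X" if "vector_field A X" for r X
    using J_lin(2)[OF vector_field_tangent[OF that] vector_field_tangent[OF that]]
    by (simp add: app_field_def fun_eq_iff scaleR_fun_def)
  have J_diff: "app_field J (X - Y) = app_field J X - app_field J Y" if "vector_field A X" "vector_field A Y" for X Y
    using J_add[OF that(1) vector_field_scaleR[OF that(2), of "-1"]] J_scale[OF that(2), of "-1"] by simp
  show "integrable_complex A J"
    unfolding integrable_complex_def
  proof (intro allI impI)
    fix X Y assume X: "vector_field A X" and Y: "vector_field A Y"
    \<comment> \<open>With every bracket written as a difference of covariant derivatives,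
      \<open>J\<close> moves outside, and \<open>JJ\<close> matches the two sides term by
      term.\<close>
    show "lie_bracket A (app_field J X) (app_field J Y) - lie_bracket A X Y =
        app_field J (lie_bracket A (app_field J X) Y + lie_bracket A X (app_field J Y))"
      using X Y
      by (simp add: torsion_free[symmetric] vfJ DJ J_add J_diff JJ vector_field_connection
          vector_field_diff)
  qed
  fix X Y assume X: "X \<in> lie_algebra mul A" and Y: "Y \<in> lie_algebra mul A"
  note vf = lie_algebra_vector_field
  \<comment> \<open>The half-bracket formula is about to be applied to \<open>app_field J X\<close>,
    which must therefore be left invariant.\<close>
  have JX: "app_field J X \<in> lie_algebra mul A"
    using X vfJ[OF vf[OF X]] inv vector_field_tangent[OF vf[OF X]]
    unfolding lie_algebra_def left_invariant_endo_def by (simp add: app_field_def)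
  have "(1/2) *\<^sub>R lie_bracket A Y (app_field J X) = app_field J ((1/2) *\<^sub>R lie_bracket A Y X)"
    using DJ[OF vf[OF Y] vf[OF X]] by (simp add: connection_eq_half_bracket X Y JX)
  then have "lie_bracket A Y (app_field J X) = app_field J (lie_bracket A Y X)"
    using X Y by (simp add: J_scale vector_field_lie_bracket vf)
  \<comment> \<open>Linearity is now known in the second argument; skewness on both sides transfers
    it to the first.\<close>
  then show "lie_bracket A (app_field J X) Y = app_field J (lie_bracket A X Y)"
    using J_scale[OF vector_field_lie_bracket[OF vf[OF Y] vf[OF X]], of "-1"]
      lie_bracket_commute[of "app_field J X" Y] lie_bracket_commute[of X Y] by simp
qed

end

theorem proposition3p5:
  fixes mul :: "'g::{t2_space, second_countable_topology} \<Rightarrow> 'g \<Rightarrow> 'g"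
    and e :: 'g
    and inve :: "'g \<Rightarrow> 'g"
    and A :: "('g, 'e::euclidean_space) chart set"
    and g :: "'g metric"
    and J :: "'g \<Rightarrow> 'g tangent \<Rightarrow> 'g tangent"
    and c :: real
  assumes "lie_group mul e inve A"
    and "left_invariant_anti_kaehler mul A g J"
    and "bi_invariant_metric mul A g"
    and "einstein A g c"
    and "c \<noteq> 0"
  shows "semisimple_lie_group mul A \<and> bi_invariant_complex_structure mul A J"
proof
  have metric: "pseudo_riemannian A g" and J: "almost_complex A J" "left_invariant_endo mul A J"
    and "\<exists>D. levi_civita A g D \<and> parallel_endo A D J"
    using assms(2) unfolding left_invariant_anti_kaehler_def anti_kaehler_def by blast+
  then obtain D where D: "levi_civita A g D" "parallel_endo A D J" by blast
  \<comment> \<open>Stated for every \<open>D\<close>: a Levi-Civita connection is determined only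
    on smooth fields, so the two that are obtained here may differ as functions.\<close>
  have bi: "bi_invariant_lie_group mul e inve A g D" if "levi_civita A g D" for D
    using assms(1,3) metric that
    unfolding bi_invariant_lie_group_def bi_invariant_lie_group_axioms_def by blast
  show "bi_invariant_complex_structure mul A J"
    using bi_invariant_lie_group.parallel_imp_bi_invariant[OF bi[OF D(1)] J D(2)] .
  obtain D' where D': "levi_civita A g D'"
    "\<And>Y Z p. vector_field A Y \<Longrightarrow> vector_field A Z \<Longrightarrow> ricci A D' Y Z p = c * g p (Y p) (Z p)"
    using assms(4) unfolding einstein_def by blast
  show "semisimple_lie_group mul A"
    using bi_invariant_lie_group.einstein_imp_semisimple[OF bi[OF D'(1)] D'(2) assms(5)] .
qed

end
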